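(* Let $f(\mathfrak{p}_1,\mathfrak{p}_2,\mathfrak{p}_3,\mathfrak{p}_4)=c_1\mathfrak{p}_1^4+c_2\mathfrak{p}_2\mathfrak{p}_1^2+c_3\mathfrak{p}_3\mathfrak{p}_1+c_4\mathfrak{p}_2^2+c_5\mathfrak{p}_4$ (with $c_i\in\mathbb{R}$) be a homogeneous symmetric function of degree $4$. Then $f$ is nonnegative in all numbers of variables if and only if the polynomial $f$ (viewed as a polynomial function of $(\mathfrak{p}_1,\mathfrak{p}_2,\mathfrak{p}_3,\mathfrak{p}_4)\in\mathbb{R}^4$) is nonnegative on the set $$\{(x,1,n^{-1/2},n^{-1}) : x\in\mathbb{R},\ n\in\mathbb{N}_{>0}\}.$$ Moreover, $f$ is a sum of squares in all numbers of variables if and only if $f$ is nonnegative on $$\{(x,1,u,u^2) : x\in\mathbb{R},\ 0\le u\le 1\}.$$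
   Context: $\mathfrak{p}_k=\sum_{i\in\mathbb{N}}X_i^k$ is the $k$-th power sum symmetric function; in $n$ variables it becomes $p_k=X_1^k+\cdots+X_n^k$. "$f$ is nonnegative (respectively a sum of squares) in all numbers of variables" means that for every $n$ the form $f(p_1,p_2,p_3,p_4)\in\mathbb{R}[X_1,\dots,X_n]$ is nonnegative on $\mathbb{R}^n$ (respectively is a sum of squares of polynomials in $\mathbb{R}[X_1,\dots,X_n]$). *)

theory Defs
  imports Complex_Main "HOL-Library.Poly_Mapping"
begin

text \<open>
  Real polynomials in variables indexed by the natural numbers: finitely supported maps from
  exponent vectors to coefficients, with the (convolution) ring structure of
  \<^theory>\<open>HOL-Library.Poly_Mapping\<close>.
\<close>

type_synonym rpoly = "(nat \<Rightarrow>\<^sub>0 nat) \<Rightarrow>\<^sub>0 real"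

definition Const :: "real \<Rightarrow> rpoly" where
  "Const c = Poly_Mapping.single 0 c"

definition Var :: "nat \<Rightarrow> rpoly" where
  "Var i = Poly_Mapping.single (Poly_Mapping.single i 1) 1"

definition vars :: "rpoly \<Rightarrow> nat set" where
  "vars p = (\<Union>m\<in>Poly_Mapping.keys p. Poly_Mapping.keys m)"

text \<open>
  Substitution of elements \<open>v i\<close> of a commutative ring for the variables, along a map \<open>\<phi>\<close>
  embedding the coefficients into that ring.
\<close>

definition subst_poly :: "(real \<Rightarrow> 'a::comm_ring_1) \<Rightarrow> (nat \<Rightarrow> 'a) \<Rightarrow> rpoly \<Rightarrow> 'a" where
  "subst_poly \<phi> v p =
     (\<Sum>m\<in>Poly_Mapping.keys p. \<phi> (Poly_Mapping.lookup p m) *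
        (\<Prod>i\<in>Poly_Mapping.keys m. v i ^ Poly_Mapping.lookup m i))"

definition eval_poly :: "rpoly \<Rightarrow> (nat \<Rightarrow> real) \<Rightarrow> real" where
  "eval_poly p x = subst_poly (\<lambda>c. c) x p"

definition power_sum :: "nat \<Rightarrow> nat \<Rightarrow> rpoly" where
  "power_sum n k = (\<Sum>i\<in>{1..n}. Var i ^ k)"

text \<open>
  A polynomial \<open>f\<close> in the variables number 1 to 4 stands for the symmetric function
  \<open>f(p\<^sub>1, p\<^sub>2, p\<^sub>3, p\<^sub>4)\<close>; the following is its specialization to the \<open>n\<close> variables
  \<open>Var 1, \<dots>, Var n\<close>.
\<close>

definition in_variables :: "nat \<Rightarrow> rpoly \<Rightarrow> rpoly" where
  "in_variables n f = subst_poly Const (power_sum n) f"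

text \<open>
  For a polynomial in \<open>Var 1, \<dots>, Var n\<close> the coordinates of \<open>x\<close> outside \<open>{1..n}\<close> do not affect
  the value, so quantifying over all \<open>x\<close> amounts to quantifying over \<open>n\<close>-dimensional real space.
\<close>

definition nonneg_poly :: "rpoly \<Rightarrow> bool" where
  "nonneg_poly p \<longleftrightarrow> (\<forall>x. eval_poly p x \<ge> 0)"

definition sos_poly :: "nat \<Rightarrow> rpoly \<Rightarrow> bool" where
  "sos_poly n p \<longleftrightarrow>
     (\<exists>qs. (\<forall>q\<in>set qs. vars q \<subseteq> {1..n}) \<and> p = (\<Sum>q\<leftarrow>qs. q ^ 2))"

definition nonneg_all_numbers_of_variables :: "rpoly \<Rightarrow> bool" where
  "nonneg_all_numbers_of_variables f \<longleftrightarrow> (\<forall>n. nonneg_poly (in_variables n f))"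

definition sos_all_numbers_of_variables :: "rpoly \<Rightarrow> bool" where
  "sos_all_numbers_of_variables f \<longleftrightarrow> (\<forall>n. sos_poly n (in_variables n f))"

definition fun4 :: "rpoly \<Rightarrow> real \<times> real \<times> real \<times> real \<Rightarrow> real" where
  "fun4 f = (\<lambda>(a, b, c, d). eval_poly f ((\<lambda>_. 0)(1 := a, 2 := b, 3 := c, 4 := d)))"

definition nonneg_on4 :: "rpoly \<Rightarrow> (real \<times> real \<times> real \<times> real) set \<Rightarrow> bool" where
  "nonneg_on4 f S \<longleftrightarrow> (\<forall>p\<in>S. fun4 f p \<ge> 0)"

end

(*
  Write F(a, b, c, d) for the value of f at the power sums a = p1, ..., d = p4; normalize p2 = 1.

  Nonnegativity. F is affine in (p3, p4). If c5 < 0, then |p3| <= 1 and p4 <= 1 bound F below by an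
  affine function of p3 on [-1, 1]. If c5 >= 0, it suffices that (|p3|, p4) lies above the polygon
  through the points (n^(-1/2), n^(-1)). This is proved by smoothing pairs of coordinates: for fixed
  u^2 + v^2 the quartic in question is unimodal in u + v, so at least one of two moves does not
  increase it: replacing (u, v) by (sqrt (u^2 + v^2), 0), or moving one of u, v to the common value
  1 / sqrt k of the k coordinates.
  Conversely, n coordinates n^(-1/2) and m small equal ones give p1 = x and approach the point
  (x, 1, n^(-1/2), n^(-1)) as m grows.

  Sums of squares. Nonnegativity on the curve says that the parabola c1 X^2 + c2 X + c4 + c5 lies
  above a concave function of X = p1^2; a separating tangent line w + w e^2 X with w >= c5 turns f into
  a copositive form in (p1^2, p2), plus w sum_i (X_i^2 + e p1 X_i)^2, plus (w - c5) (p2^2 - p4).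
  Conversely, if f is a sum of squares then it is a sum of squares of quadratic forms, and a signed
  measure on points with (p1, p2) close to (x, 1) that is nonnegative on squares of quadratic functions
  integrates f to approximately F(x, 1, u, u^2).
*)
theory Submission
  imports Defs "HOL-Computational_Algebra.Polynomial" "HOL-Real_Asymp.Real_Asymp"
begin

section \<open>Substitution homomorphisms\<close>

text \<open>Coefficients of a sum may cancel and its keys shrink, so polynomials are compared over a
  common larger index set; \<open>\<phi> 0 = 0\<close> makes the extra terms vanish.\<close>

lemma subst_poly_superset:
  assumes "\<phi> 0 = 0" "finite M" "Poly_Mapping.keys p \<subseteq> M"
  shows "subst_poly \<phi> v p = (\<Sum>m\<in>M. \<phi> (Poly_Mapping.lookup p m) *
        (\<Prod>i\<in>Poly_Mapping.keys m. v i ^ Poly_Mapping.lookup m i))"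
  unfolding subst_poly_def
  by (rule sum.mono_neutral_left) (use assms in \<open>auto simp: in_keys_iff\<close>)

lemma prod_keys_superset:
  fixes v :: "nat \<Rightarrow> 'a::comm_ring_1"
  assumes "finite I" "Poly_Mapping.keys m \<subseteq> I"
  shows "(\<Prod>i\<in>Poly_Mapping.keys m. v i ^ Poly_Mapping.lookup m i) = (\<Prod>i\<in>I. v i ^ Poly_Mapping.lookup m i)"
  by (rule prod.mono_neutral_left) (use assms in \<open>auto simp: in_keys_iff\<close>)

lemma prod_keys_add:
  fixes v :: "nat \<Rightarrow> 'a::comm_ring_1"
  shows "(\<Prod>i\<in>Poly_Mapping.keys (m + m'). v i ^ Poly_Mapping.lookup (m + m') i)
    = (\<Prod>i\<in>Poly_Mapping.keys m. v i ^ Poly_Mapping.lookup m i) *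
      (\<Prod>i\<in>Poly_Mapping.keys m'. v i ^ Poly_Mapping.lookup m' i)"
proof -
  let ?I = "Poly_Mapping.keys m \<union> Poly_Mapping.keys m'"
  show ?thesis
    by (subst (1 2 3) prod_keys_superset[where I = ?I])
      (auto simp: lookup_add power_add prod.distrib dest: set_mp[OF keys_add])
qed

text \<open>Covers three substitutions at once: evaluation at real points, specialization to power
  sums, and restriction to a ray, with values in \<open>real\<close>, \<open>rpoly\<close> and
  \<open>real poly\<close>.\<close>

locale coefficient_hom =
  fixes \<phi> :: "real \<Rightarrow> 'a::comm_ring_1"
  assumes zero: "\<phi> 0 = 0" and one: "\<phi> 1 = 1"
    and add: "\<phi> (a + b) = \<phi> a + \<phi> b" and mult: "\<phi> (a * b) = \<phi> a * \<phi> b"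
begin

lemma subst_zero [simp]: "subst_poly \<phi> v 0 = 0"
  by (simp add: subst_poly_def)

lemma subst_single:
  "subst_poly \<phi> v (Poly_Mapping.single m c) =
    \<phi> c * (\<Prod>i\<in>Poly_Mapping.keys m. v i ^ Poly_Mapping.lookup m i)"
  by (cases "c = 0") (auto simp: subst_poly_def zero)

lemma subst_Const [simp]: "subst_poly \<phi> v (Const c) = \<phi> c"
  by (simp add: Const_def subst_single)

lemma subst_Var [simp]: "subst_poly \<phi> v (Var i) = v i"
  by (simp add: Var_def subst_single one)

lemma subst_one [simp]: "subst_poly \<phi> v 1 = 1"
  using subst_Const[of v 1] by (simp add: Const_def one)

lemma subst_add [simp]: "subst_poly \<phi> v (p + q) = subst_poly \<phi> v p + subst_poly \<phi> v q"
proof -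
  let ?M = "Poly_Mapping.keys p \<union> Poly_Mapping.keys q"
  show ?thesis
    by (subst (1 2 3) subst_poly_superset[where M = ?M])
      (auto simp: lookup_add add zero algebra_simps sum.distrib dest: set_mp[OF keys_add])
qed

lemma subst_sum [simp]: "subst_poly \<phi> v (\<Sum>i\<in>I. g i) = (\<Sum>i\<in>I. subst_poly \<phi> v (g i))"
  by (induction I rule: infinite_finite_induct) auto

lemma subst_mult [simp]: "subst_poly \<phi> v (p * q) = subst_poly \<phi> v p * subst_poly \<phi> v q"
proof -
  \<comment> \<open>By bilinearity it is enough to multiply single monomials, where exponents add
    up.\<close>
  have expand: "r = (\<Sum>m\<in>Poly_Mapping.keys r. Poly_Mapping.single m (Poly_Mapping.lookup r m))"
    for r :: rpoly
    by (rule poly_mapping_eqI) (auto simp: lookup_sum lookup_single when_def in_keys_iff)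
  have "subst_poly \<phi> v (Poly_Mapping.single m c * Poly_Mapping.single m' c') =
      subst_poly \<phi> v (Poly_Mapping.single m c) * subst_poly \<phi> v (Poly_Mapping.single m' c')"
    for m m' c c'
    by (simp add: mult_single subst_single mult prod_keys_add)
  then show ?thesis
    by (subst (1 2) expand[of p], subst (1 2) expand[of q])
      (simp add: sum_distrib_left sum_distrib_right)
qed

lemma subst_power [simp]: "subst_poly \<phi> v (p ^ k) = subst_poly \<phi> v p ^ k"
  by (induction k) auto

lemma subst_sum_list [simp]:
  "subst_poly \<phi> v (\<Sum>q\<leftarrow>qs. g q) = (\<Sum>q\<leftarrow>qs. subst_poly \<phi> v (g q))"
  by (induction qs) auto

end

interpretation eval: coefficient_hom "\<lambda>c::real. c"
  by unfold_locales auto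

interpretation const: coefficient_hom Const
  by unfold_locales (auto simp: Const_def single_add mult_single)

interpretation pconst: coefficient_hom "\<lambda>c::real. [:c:]"
  by unfold_locales auto

lemma eval_simps [simp]:
  "eval_poly (p + q) x = eval_poly p x + eval_poly q x"
  "eval_poly (p * q) x = eval_poly p x * eval_poly q x"
  "eval_poly (p ^ k) x = eval_poly p x ^ k"
  "eval_poly (Const c) x = c" "eval_poly (Var i) x = x i"
  "eval_poly (sum g I) x = (\<Sum>i\<in>I. eval_poly (g i) x)"
  by (auto simp: eval_poly_def)

section \<open>The quartic as a real function, and its specializations\<close>

definition form4 :: "real \<Rightarrow> real \<Rightarrow> real \<Rightarrow> real \<Rightarrow> real \<Rightarrow> real \<Rightarrow> real \<Rightarrow> real \<Rightarrow> real \<Rightarrow> real" where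
  "form4 c1 c2 c3 c4 c5 a b c d = c1 * a ^ 4 + c2 * b * a ^ 2 + c3 * c * a + c4 * b ^ 2 + c5 * d"

context
  fixes c1 c2 c3 c4 c5 :: real and f :: rpoly
  assumes f: "f = Const c1 * Var 1 ^ 4 + Const c2 * Var 2 * Var 1 ^ 2 + Const c3 * Var 3 * Var 1
                + Const c4 * Var 2 ^ 2 + Const c5 * Var 4"
begin

lemma fun4_form4: "fun4 f (a, b, c, d) = form4 c1 c2 c3 c4 c5 a b c d"
  by (simp add: fun4_def f form4_def)

lemma in_variables_form:
  "in_variables n f = Const c1 * power_sum n 1 ^ 4 + Const c2 * power_sum n 2 * power_sum n 1 ^ 2
     + Const c3 * power_sum n 3 * power_sum n 1 + Const c4 * power_sum n 2 ^ 2
     + Const c5 * power_sum n 4"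
  by (simp add: in_variables_def f)

lemma eval_in_variables:
  "eval_poly (in_variables n f) x = form4 c1 c2 c3 c4 c5
     (\<Sum>i\<in>{1..n}. x i) (\<Sum>i\<in>{1..n}. x i ^ 2) (\<Sum>i\<in>{1..n}. x i ^ 3) (\<Sum>i\<in>{1..n}. x i ^ 4)"
  by (simp add: in_variables_form form4_def power_sum_def)

text \<open>Homogeneity of degree 4: on the ray through \<open>x\<close> the specialization is t^4
  times its value at \<open>x\<close>. This later isolates the degree 2 parts of the summands of a
  sum of squares.\<close>

lemma subst_monom_in_variables:
  "subst_poly (\<lambda>c. [:c:]) (\<lambda>i. monom (x i) 1) (in_variables n f) =
    monom (eval_poly (in_variables n f) x) 4"
proof -
  have ps: "subst_poly (\<lambda>c. [:c:]) (\<lambda>i. monom (x i) 1) (power_sum n k) =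
      monom (\<Sum>i\<in>{1..n}. x i ^ k) k" for k
    by (rule poly_eqI) (simp add: power_sum_def coeff_sum monom_power)
  have const: "[:c:] = monom c 0" for c :: real
    by (simp add: monom_0)
  show ?thesis
    unfolding eval_in_variables
    unfolding in_variables_form pconst.subst_add pconst.subst_mult pconst.subst_power
      pconst.subst_Const ps form4_def
    unfolding const by (simp add: mult_monom monom_power add_monom mult_ac)
qed

end

section \<open>Smoothing on the sphere\<close>

text \<open>Once u^2 + v^2 is fixed, the quartic depends on p = u + v alone, because 2uv = p^2 -
  (u^2 + v^2).\<close>

lemma power_sums_pair_identity:
  fixes u v :: real
  shows "2 * (u ^ 4 + v ^ 4 - g * (u ^ 3 + v ^ 3)) = 2 * (u\<^sup>2 + v\<^sup>2)\<^sup>2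
    - ((u + v)\<^sup>2 - (u\<^sup>2 + v\<^sup>2))\<^sup>2 - g * (u + v) * (3 * (u\<^sup>2 + v\<^sup>2) - (u + v)\<^sup>2)"
  by algebra

text \<open>In p = u + v, with u^2 + v^2 = r^2 fixed, twice the quartic has derivative (p^2 -
  r^2)(3g - 4p). For p >= r it rises up to p = 3g/4 and falls afterwards, so its value at p is at
  least the one at r or the one at any given p' >= p.\<close>

lemma pair_quasiconcave:
  fixes u v u' v' r g :: real
  assumes nonneg: "0 \<le> u" "0 \<le> v" "0 \<le> r"
    and r: "u\<^sup>2 + v\<^sup>2 = r\<^sup>2" "u'\<^sup>2 + v'\<^sup>2 = r\<^sup>2" and s: "u + v \<le> u' + v'"
  shows "r ^ 4 - g * r ^ 3 \<le> u ^ 4 + v ^ 4 - g * (u ^ 3 + v ^ 3)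
    \<or> u' ^ 4 + v' ^ 4 - g * (u' ^ 3 + v' ^ 3) \<le> u ^ 4 + v ^ 4 - g * (u ^ 3 + v ^ 3)"
proof -
  define p where "p = u + v"
  define p' where "p' = u' + v'"
  have "r\<^sup>2 \<le> p\<^sup>2" using nonneg r by (simp add: p_def power2_sum)
  then have rp: "r \<le> p" by (rule power2_le_imp_le) (use nonneg in \<open>auto simp: p_def\<close>)
  have pp: "p \<le> p'" using s by (simp add: p_def p'_def)
  let ?phi = "\<lambda>p. 2 * (r\<^sup>2)\<^sup>2 - (p\<^sup>2 - r\<^sup>2)\<^sup>2 - g * p * (3 * r\<^sup>2 - p\<^sup>2)"
  have below: "2 * (r ^ 4 - g * r ^ 3) \<le> ?phi p" if "3 * g \<ge> 4 * p"
  proof -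
    \<comment> \<open>The difference to the value at r is (p - r)^2 (g (p + 2r) - (p + r)^2),
      nondecreasing in g; at the extreme g = 4p/3 the second factor is (p - r)(p + 3r)/3.\<close>
    have "0 \<le> (p - r) * (p + 3 * r)" using rp nonneg by simp
    also have "\<dots> = 4 * p * (p + 2 * r) - 3 * (p + r)\<^sup>2"
      by (simp add: power2_eq_square algebra_simps)
    also have "\<dots> \<le> 3 * g * (p + 2 * r) - 3 * (p + r)\<^sup>2"
      using that rp nonneg by (intro diff_right_mono mult_right_mono) auto
    finally have "0 \<le> (p - r)\<^sup>2 * (g * (p + 2 * r) - (p + r)\<^sup>2)" by simp
    also have "\<dots> = ?phi p - 2 * (r ^ 4 - g * r ^ 3)"
      by algebra
    finally show ?thesis by simp
  qed
  have above: "?phi p' \<le> ?phi p" if "3 * g \<le> 4 * p"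
  proof -
    \<comment> \<open>In the difference of the values at p and p', divided by p' - p, the
      coefficient of g is \<open>- ?T\<close>; since \<open>?T\<close> is nonnegative, g = 4p/3 is
      again the extreme case.\<close>
    let ?T = "p'\<^sup>2 + p * p' + p\<^sup>2 - 3 * r\<^sup>2"
    have "r * r \<le> p * p" "r * r \<le> p * p'" "r * r \<le> p' * p'"
      using rp pp nonneg by (auto intro!: mult_mono)
    then have T: "0 \<le> ?T" by (simp add: power2_eq_square)
    have "0 \<le> (p' - p) * ((p' - p) * (3 * p' + 5 * p) + 6 * (p\<^sup>2 - r\<^sup>2))"
      using rp pp nonneg \<open>r\<^sup>2 \<le> p\<^sup>2\<close> by simp
    also have "\<dots> = 3 * (p + p') * (p\<^sup>2 + p'\<^sup>2 - 2 * r\<^sup>2) - 4 * p * ?T"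
      by (simp add: power2_eq_square algebra_simps)
    also have "\<dots> \<le> 3 * (p + p') * (p\<^sup>2 + p'\<^sup>2 - 2 * r\<^sup>2) - 3 * g * ?T"
      using that T by (intro diff_left_mono mult_right_mono) auto
    finally have "3 * (g * ?T) \<le> 3 * ((p + p') * (p\<^sup>2 + p'\<^sup>2 - 2 * r\<^sup>2))"
      by (simp only: mult.assoc diff_ge_0_iff_ge)
    then have "0 \<le> (p' - p) * ((p + p') * (p\<^sup>2 + p'\<^sup>2 - 2 * r\<^sup>2) - g * ?T)"
      using pp by (intro mult_nonneg_nonneg) linarith+
    also have "\<dots> = ?phi p - ?phi p'"
      by algebra
    finally show ?thesis by simp
  qed
  have phi: "2 * (u ^ 4 + v ^ 4 - g * (u ^ 3 + v ^ 3)) = ?phi p"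
    unfolding power_sums_pair_identity r p_def by simp
  have phi': "2 * (u' ^ 4 + v' ^ 4 - g * (u' ^ 3 + v' ^ 3)) = ?phi p'"
    unfolding power_sums_pair_identity r p'_def by simp
  show ?thesis
  proof (cases "4 * p \<le> 3 * g")
    case True
    show ?thesis using below[OF True, folded phi] by (intro disjI1) simp
  next
    case False
    then have "3 * g \<le> 4 * p" by simp
    from above[OF this, folded phi phi'] show ?thesis by (intro disjI2) simp
  qed
qed

lemma sum_insert2:
  fixes F :: "'a \<Rightarrow> 'b::ab_group_add"
  assumes "finite A" "i \<in> A" "j \<in> A" "i \<noteq> j"
  shows "sum F A = F i + F j + sum F (A - {i, j})"
proof -
  have "sum F A = F i + (F j + sum F (A - {i} - {j}))"
    using assms by (simp add: sum.remove)
  also have "A - {i} - {j} = A - {i, j}" by auto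
  finally show ?thesis by (simp add: add.assoc)
qed

text \<open>
  Induction on the number of coordinates and then on the number of coordinates that differ from
  \<open>1 / sqrt (card A)\<close>.
\<close>

lemma sphere_quartic_nonneg:
  fixes y :: "'a \<Rightarrow> real" and g h :: real
  assumes base: "\<And>k. 0 < k \<Longrightarrow> 0 \<le> (1 / sqrt (real k))\<^sup>2 - g * (1 / sqrt (real k)) + h"
  shows "finite A \<Longrightarrow> (\<And>i. i \<in> A \<Longrightarrow> 0 \<le> y i) \<Longrightarrow> (\<Sum>i\<in>A. (y i)\<^sup>2) = 1 \<Longrightarrow>
    0 \<le> (\<Sum>i\<in>A. y i ^ 4 - g * y i ^ 3 + h * (y i)\<^sup>2)"
proof (induction "card A" arbitrary: A y rule: less_induct)
  case (less A y)
  let ?psi = "\<lambda>t. t ^ 4 - g * t ^ 3 + h * t\<^sup>2"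
  note smaller = less.hyps and finA = less.prems(1)
  define q where "q = 1 / sqrt (card A)"
  have "A \<noteq> {}" using less.prems(3) by auto
  then have cardA: "0 < card A" using finA by auto
  then have q: "q > 0" "card A * q\<^sup>2 = 1" by (auto simp: q_def power_divide)
  have "0 \<le> (\<Sum>i\<in>A. ?psi (z i))" if "\<And>i. i \<in> A \<Longrightarrow> 0 \<le> z i" "(\<Sum>i\<in>A. (z i)\<^sup>2) = 1" for z
    using that
  proof (induction "card {i \<in> A. z i \<noteq> q}" arbitrary: z rule: less_induct)
    case (less z)
    note nonneg = less.prems(1) and sphere = less.prems(2)
    show ?case
    proof (cases "\<forall>i\<in>A. z i = q")
      case True
      then have "(\<Sum>i\<in>A. ?psi (z i)) = card A * ?psi q" by simp
      also have "\<dots> = (card A * q\<^sup>2) * (q\<^sup>2 - g * q + h)"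
        by (simp add: power2_eq_square power3_eq_cube power4_eq_xxxx algebra_simps)
      also have "\<dots> \<ge> 0" using q base[OF cardA] by (simp add: q_def)
      finally show ?thesis .
    next
      case False
      have sq: "(z i)\<^sup>2 \<le> q\<^sup>2 \<longleftrightarrow> z i \<le> q" "(z i)\<^sup>2 < q\<^sup>2 \<longleftrightarrow> z i < q"
        "q\<^sup>2 \<le> (z i)\<^sup>2 \<longleftrightarrow> q \<le> z i" "q\<^sup>2 < (z i)\<^sup>2 \<longleftrightarrow> q < z i" if "i \<in> A" for i
        using nonneg[OF that] q by (simp_all add: power_mono_iff flip: not_le)
      have total: "(\<Sum>i\<in>A. (z i)\<^sup>2) = (\<Sum>i\<in>A. q\<^sup>2)" using sphere q by simp
      \<comment> \<open>The squares have mean q^2, so coordinates other than q cannot all lie on one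
        side of it.\<close>
      have "\<exists>i\<in>A. z i < q"
      proof (rule ccontr)
        assume "\<not> ?thesis"
        then have ge: "\<forall>i\<in>A. q \<le> z i" by auto
        with False obtain j where "j \<in> A" "q < z j" by force
        then have "(\<Sum>i\<in>A. q\<^sup>2) < (\<Sum>i\<in>A. (z i)\<^sup>2)"
          using ge sq finA by (intro sum_strict_mono_ex1) auto
        then show False using total by simp
      qed
      then obtain i where i: "i \<in> A" "z i < q" by auto
      have "\<exists>j\<in>A. q < z j"
      proof (rule ccontr)
        assume "\<not> ?thesis"
        then have "\<forall>j\<in>A. z j \<le> q" by auto
        then have "(\<Sum>i\<in>A. (z i)\<^sup>2) < (\<Sum>i\<in>A. q\<^sup>2)"
          using i sq finA by (intro sum_strict_mono_ex1) auto
        then show False using total by simp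
      qed
      then obtain j where j: "j \<in> A" "q < z j" by auto
      define u v where "u = z i" and "v = z j"
      have uv: "0 \<le> u" "u < q" "q < v" using i j nonneg by (auto simp: u_def v_def)
      have ij: "i \<noteq> j" using i j by auto
      \<comment> \<open>Two replacements that keep u^2 + v^2: \<open>(r, 0)\<close> empties a
        coordinate and serves the outer induction; \<open>(q, v')\<close> settles one at the common
        value and serves the inner induction.\<close>
      define r v' where "r = sqrt (u\<^sup>2 + v\<^sup>2)" and "v' = sqrt (u\<^sup>2 + v\<^sup>2 - q\<^sup>2)"
      have "q\<^sup>2 < v\<^sup>2" "u\<^sup>2 < q\<^sup>2" using uv q by (auto intro: power_strict_mono)
      moreover from this have "q\<^sup>2 \<le> u\<^sup>2 + v\<^sup>2"
        using zero_le_power2[of u] by linarith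
      ultimately have v': "0 \<le> v'" "v'\<^sup>2 = u\<^sup>2 + v\<^sup>2 - q\<^sup>2" and r: "0 \<le> r" "r\<^sup>2 = u\<^sup>2 + v\<^sup>2"
        by (auto simp: r_def v'_def)
      \<comment> \<open>Since u < q < v, the pair \<open>(q, v')\<close> is closer to balanced than
        \<open>(u, v)\<close>, so its product and hence its sum are at least as large.\<close>
      have "0 \<le> (q\<^sup>2 - u\<^sup>2) * (v\<^sup>2 - q\<^sup>2)"
        using \<open>q\<^sup>2 < v\<^sup>2\<close> \<open>u\<^sup>2 < q\<^sup>2\<close> by simp
      also have "\<dots> = (q * v')\<^sup>2 - (u * v)\<^sup>2"
        unfolding power_mult_distrib v' by (simp add: algebra_simps power2_eq_square)
      finally have "(u * v)\<^sup>2 \<le> (q * v')\<^sup>2" by simp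
      then have "u * v \<le> q * v'" by (rule power2_le_imp_le) (use q v' in auto)
      then have "(u + v)\<^sup>2 \<le> (q + v')\<^sup>2" using v' by (simp add: power2_sum)
      then have "u + v \<le> q + v'" by (rule power2_le_imp_le) (use q v' in auto)
      then have "r ^ 4 - g * r ^ 3 \<le> u ^ 4 + v ^ 4 - g * (u ^ 3 + v ^ 3)
        \<or> q ^ 4 + v' ^ 4 - g * (q ^ 3 + v' ^ 3) \<le> u ^ 4 + v ^ 4 - g * (u ^ 3 + v ^ 3)"
        using uv v' r q by (intro pair_quasiconcave) simp_all
      then consider
        "r ^ 4 - g * r ^ 3 \<le> u ^ 4 + v ^ 4 - g * (u ^ 3 + v ^ 3)"
        | "q ^ 4 + v' ^ 4 - g * (q ^ 3 + v' ^ 3) \<le> u ^ 4 + v ^ 4 - g * (u ^ 3 + v ^ 3)"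
        by blast
      then show ?thesis
      proof cases
        case 1
        let ?z = "z(j := r)" and ?R = "A - {i, j}"
        have sum_z: "(\<Sum>k\<in>A - {i}. F (?z k)) = F r + (\<Sum>k\<in>?R. F (z k))" for F :: "real \<Rightarrow> real"
        proof -
          have "(\<Sum>k\<in>A - {i}. F (?z k)) = F (?z j) + (\<Sum>k\<in>A - {i} - {j}. F (?z k))"
            using finA j ij by (intro sum.remove) auto
          also have "A - {i} - {j} = ?R" by auto
          finally show ?thesis by (auto intro!: sum.cong)
        qed
        have "0 \<le> (\<Sum>k\<in>A - {i}. ?psi (?z k))"
        proof (rule smaller)
          show "card (A - {i}) < card A" using finA i by (intro psubset_card_mono) auto
          show "0 \<le> ?z k" if "k \<in> A - {i}" for k using that nonneg r by auto
          show "(\<Sum>k\<in>A - {i}. (?z k)\<^sup>2) = 1"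
            using sphere sum_insert2[OF finA i(1) j(1) ij, of "\<lambda>k. (z k)\<^sup>2"] r
            unfolding sum_z[of "\<lambda>t. t\<^sup>2"] by (simp add: u_def v_def)
        qed (use finA in auto)
        also have "\<dots> = ?psi r + (\<Sum>k\<in>?R. ?psi (z k))" by (rule sum_z)
        also have "?psi r \<le> ?psi u + ?psi v" using 1 r by (simp add: algebra_simps)
        finally show ?thesis
          using sum_insert2[OF finA i(1) j(1) ij, of "\<lambda>k. ?psi (z k)"] by (simp add: u_def v_def)
      next
        case 2
        let ?z = "z(i := q, j := v')" and ?R = "A - {i, j}"
        have sum_z: "(\<Sum>k\<in>A. F (?z k)) = F q + F v' + (\<Sum>k\<in>?R. F (z k))" for F :: "real \<Rightarrow> real"
          using sum_insert2[OF finA i(1) j(1) ij, of "\<lambda>k. F (?z k)"] ij by simp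
        have h: "h * u\<^sup>2 + h * v\<^sup>2 = h * q\<^sup>2 + h * v'\<^sup>2"
          using v' by (simp flip: distrib_left)
        have "0 \<le> (\<Sum>k\<in>A. ?psi (?z k))"
        proof (rule less.hyps)
          show "card {k \<in> A. ?z k \<noteq> q} < card {k \<in> A. z k \<noteq> q}"
            using finA i j ij by (intro psubset_card_mono) (auto split: if_splits)
          show "0 \<le> ?z k" if "k \<in> A" for k using that nonneg v' q by auto
          show "(\<Sum>k\<in>A. (?z k)\<^sup>2) = 1"
            using sphere sum_insert2[OF finA i(1) j(1) ij, of "\<lambda>k. (z k)\<^sup>2"] v'
            unfolding sum_z[of "\<lambda>t. t\<^sup>2"] by (simp add: u_def v_def)
        qed
        also have "\<dots> = ?psi q + ?psi v' + (\<Sum>k\<in>?R. ?psi (z k))" by (rule sum_z)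
        also have "?psi q + ?psi v' \<le> ?psi u + ?psi v" using 2 h by (simp add: algebra_simps)
        finally show ?thesis
          using sum_insert2[OF finA i(1) j(1) ij, of "\<lambda>k. ?psi (z k)"] by (simp add: u_def v_def)
      qed
    qed
  qed
  then show ?case using less.prems by auto
qed

section \<open>Nonnegativity\<close>

text \<open>The bound is the line through the points (t, t^2) for t = a n and t = a (n + 1), an edge
  of the polygon. No a k lies strictly between these two, so (t - a n)(t - a (n + 1)) is nonnegative
  at every a k, and \<open>sphere_quartic_nonneg\<close> applies to the absolute values.\<close>

lemma power_sum4_ge:
  fixes y :: "'a \<Rightarrow> real"
  assumes A: "finite A" "(\<Sum>i\<in>A. (y i)\<^sup>2) = 1"
    and "0 < n"
  defines "a \<equiv> \<lambda>n. 1 / sqrt (real n)"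
  shows "(a n + a (Suc n)) * \<bar>\<Sum>i\<in>A. y i ^ 3\<bar> - a n * a (Suc n) \<le> (\<Sum>i\<in>A. y i ^ 4)"
proof -
  define g h where "g = a n + a (Suc n)" and "h = a n * a (Suc n)"
  have mono: "a k \<le> a m" if "0 < m" "m \<le> k" for k m
    using that by (auto simp: a_def intro!: divide_left_mono)
  have a0: "0 \<le> a k" for k by (simp add: a_def)
  have base: "0 \<le> (a k)\<^sup>2 - g * a k + h" if "0 < k" for k
  proof -
    have "(a k)\<^sup>2 - g * a k + h = (a k - a n) * (a k - a (Suc n))"
      by (simp add: g_def h_def power2_eq_square algebra_simps)
    also have "\<dots> \<ge> 0"
    proof (cases "k \<le> n")
      case True
      then show ?thesis using that mono[of k n] mono[of k "Suc n"] by simp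
    next
      case False
      then have "a k \<le> a n" "a k \<le> a (Suc n)" using \<open>0 < n\<close> by (auto intro: mono)
      then show ?thesis by (simp add: mult_nonpos_nonpos)
    qed
    finally show ?thesis .
  qed
  have "0 \<le> (\<Sum>i\<in>A. \<bar>y i\<bar> ^ 4 - g * \<bar>y i\<bar> ^ 3 + h * \<bar>y i\<bar>\<^sup>2)"
    using A base unfolding a_def by (intro sphere_quartic_nonneg) auto
  also have "\<dots> = (\<Sum>i\<in>A. y i ^ 4) - g * (\<Sum>i\<in>A. \<bar>y i\<bar> ^ 3) + h"
    using A by (simp add: sum.distrib sum_subtractf flip: sum_distrib_left)
  finally have "g * (\<Sum>i\<in>A. \<bar>y i\<bar> ^ 3) - h \<le> (\<Sum>i\<in>A. y i ^ 4)" by simp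
  moreover have "\<bar>\<Sum>i\<in>A. y i ^ 3\<bar> \<le> (\<Sum>i\<in>A. \<bar>y i\<bar> ^ 3)"
    using sum_abs[of "\<lambda>i. y i ^ 3" A] by (simp add: power_abs)
  then have "g * \<bar>\<Sum>i\<in>A. y i ^ 3\<bar> \<le> g * (\<Sum>i\<in>A. \<bar>y i\<bar> ^ 3)"
    using a0 by (intro mult_left_mono) (auto simp: g_def)
  ultimately show ?thesis unfolding g_def h_def by linarith
qed


lemma form4_scale:
  "form4 c1 c2 c3 c4 c5 (s * a) (s\<^sup>2 * b) (s ^ 3 * c) (s ^ 4 * d) = s ^ 4 * form4 c1 c2 c3 c4 c5 a b c d"
  unfolding form4_def by algebra

lemma form4_minus: "form4 c1 c2 c3 c4 c5 (- a) b (- c) d = form4 c1 c2 c3 c4 c5 a b c d"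
  by (simp add: form4_def)

lemma form4_affine:
  "form4 c1 c2 c3 c4 c5 a b (t * c + (1 - t) * c') (t * d + (1 - t) * d') =
    t * form4 c1 c2 c3 c4 c5 a b c d + (1 - t) * form4 c1 c2 c3 c4 c5 a b c' d'"
  unfolding form4_def by algebra

lemma form4_mono: "c5 * d \<le> c5 * d' \<Longrightarrow> form4 c1 c2 c3 c4 c5 a b c d \<le> form4 c1 c2 c3 c4 c5 a b c d'"
  by (simp add: form4_def)

lemma form4_nonneg_sphere:
  fixes y :: "'a \<Rightarrow> real"
  assumes pos: "\<And>x n. 0 < n \<Longrightarrow> 0 \<le> form4 c1 c2 c3 c4 c5 x 1 (1 / sqrt (real n)) (1 / real n)"
    and A: "finite A" "(\<Sum>i\<in>A. (y i)\<^sup>2) = 1"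
  shows "0 \<le> form4 c1 c2 c3 c4 c5 (\<Sum>i\<in>A. y i) 1 (\<Sum>i\<in>A. y i ^ 3) (\<Sum>i\<in>A. y i ^ 4)"
proof -
  let ?F = "form4 c1 c2 c3 c4 c5"
  define P Q where "P = \<bar>\<Sum>i\<in>A. y i ^ 3\<bar>" and "Q = (\<Sum>i\<in>A. y i ^ 4)"
  have le1: "\<bar>y i\<bar> \<le> 1" if "i \<in> A" for i
  proof -
    have "(y i)\<^sup>2 \<le> 1" using A that by (metis member_le_sum zero_le_power2)
    then show ?thesis by (simp add: abs_square_le_1)
  qed
  have "\<bar>y i ^ 3\<bar> \<le> (y i)\<^sup>2" "y i ^ 4 \<le> (y i)\<^sup>2" if "i \<in> A" for i
    using le1[OF that] power_decreasing[of 2 3 "\<bar>y i\<bar>"] power_decreasing[of 2 4 "\<bar>y i\<bar>"]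
    by (simp_all add: power_abs)
  then have "(\<Sum>i\<in>A. \<bar>y i ^ 3\<bar>) \<le> 1" and Q1: "Q \<le> 1"
    unfolding Q_def A(2)[symmetric] by (auto intro: sum_mono)
  then have P1: "P \<le> 1"
    unfolding P_def by (blast intro: order_trans[OF sum_abs])
  have P0: "0 \<le> P" and Q0: "0 \<le> Q" by (simp_all add: P_def Q_def sum_nonneg)
  \<comment> \<open>Proved for every \<open>X\<close>, so that a negative third power sum can be
    handled at the end by flipping both signs with \<open>form4_minus\<close>.\<close>
  have "0 \<le> ?F X 1 P Q" for X
  proof (cases "c5 < 0")
    case True
    have "0 \<le> ?F X 1 1 1" "0 \<le> ?F X 1 (-1) 1"
      using pos[of 1 X] pos[of 1 "-X"] form4_minus[of c1 c2 c3 c4 c5 X 1 "-1" 1] by auto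
    then have "0 \<le> (1 + P) / 2 * ?F X 1 1 1 + (1 - (1 + P) / 2) * ?F X 1 (-1) 1"
      using P0 P1 by (intro add_nonneg_nonneg mult_nonneg_nonneg) auto
    also have "\<dots> = ?F X 1 P 1"
      unfolding form4_affine[symmetric] by (simp add: field_simps)
    also have "\<dots> \<le> ?F X 1 P Q" using True Q1 by (intro form4_mono) simp
    finally show ?thesis .
  next
    case c5: False
    show ?thesis
    proof (cases "P = 0")
      case True
      \<comment> \<open>No edge reaches 0, but the vertices of the polygon converge to (0,
        0).\<close>
      have "(\<lambda>n. ?F X 1 (1 / sqrt (real n)) (1 / real n)) \<longlonglongrightarrow> ?F X 1 0 0"
        unfolding form4_def by (intro tendsto_intros) real_asymp+
      then have "0 \<le> ?F X 1 0 0"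
        by (rule tendsto_lowerbound) (auto intro!: eventually_sequentiallyI[of 1] pos)
      also have "\<dots> \<le> ?F X 1 P Q" using True Q0 c5 by (auto intro: form4_mono)
      finally show ?thesis .
    next
      case False
      \<comment> \<open>Selects the edge over P: 1 / sqrt (n + 1) <= P <= 1 / sqrt n.\<close>
      define n where "n = nat \<lfloor>1 / P\<^sup>2\<rfloor>"
      define a b where "a = 1 / sqrt (real n)" and "b = 1 / sqrt (real (Suc n))"
      have P: "0 < P" using P0 False by simp
      have "1 \<le> 1 / P\<^sup>2" using P P1 by (simp add: power_le_one)
      then have n: "0 < n" "real n \<le> 1 / P\<^sup>2" "1 / P\<^sup>2 < real (Suc n)"
        unfolding n_def by linarith+
      have "1 / sqrt (1 / P\<^sup>2) = P" using P by (simp add: real_sqrt_divide)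
      moreover have "1 / sqrt (1 / P\<^sup>2) \<le> a"
        unfolding a_def using n P by (intro divide_left_mono) auto
      moreover have "b \<le> 1 / sqrt (1 / P\<^sup>2)"
        unfolding b_def using n P by (intro divide_left_mono) auto
      moreover have ba: "b < a"
        unfolding a_def b_def using n by (intro divide_strict_left_mono) auto
      ultimately have ab: "b \<le> P" "P \<le> a" by auto
      define t where "t = (P - b) / (a - b)"
      have t: "0 \<le> t" "t \<le> 1" using ab ba by (auto simp: t_def)
      have "t * (a - b) = P - b" using ba by (simp add: t_def)
      then have tP: "t * a + (1 - t) * b = P" by (simp add: algebra_simps)
      have sq: "a\<^sup>2 = 1 / real n" "b\<^sup>2 = 1 / real (Suc n)"
        using n by (auto simp: a_def b_def power_divide)
      have "t * a\<^sup>2 + (1 - t) * b\<^sup>2 = (a + b) * P - a * b"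
        unfolding tP[symmetric] by algebra
      also have "\<dots> \<le> Q"
        using power_sum4_ge[OF A n(1)] by (simp add: P_def Q_def a_def b_def)
      finally have Q: "t * a\<^sup>2 + (1 - t) * b\<^sup>2 \<le> Q" .
      have "0 \<le> t * ?F X 1 a (a\<^sup>2) + (1 - t) * ?F X 1 b (b\<^sup>2)"
        using t pos[OF n(1), of X] pos[of "Suc n" X]
        unfolding sq unfolding a_def b_def by (intro add_nonneg_nonneg mult_nonneg_nonneg) auto
      also have "\<dots> = ?F X 1 P (t * a\<^sup>2 + (1 - t) * b\<^sup>2)"
        unfolding form4_affine[symmetric] tP ..
      also have "\<dots> \<le> ?F X 1 P Q" using Q c5 by (intro form4_mono mult_left_mono) auto
      finally show ?thesis .
    qed
  qed
  from this[of "\<Sum>i\<in>A. y i"] this[of "- (\<Sum>i\<in>A. y i)"] show ?thesis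
    using form4_minus[of c1 c2 c3 c4 c5 "\<Sum>i\<in>A. y i" 1 "\<Sum>i\<in>A. y i ^ 3" Q]
    by (cases "0 \<le> (\<Sum>i\<in>A. y i ^ 3)") (auto simp: P_def Q_def abs_if)
qed

text \<open>Reduces to the unit sphere by dividing by the Euclidean norm and using homogeneity; the
  zero vector is treated separately.\<close>

lemma form4_nonneg_power_sums:
  fixes y :: "'a \<Rightarrow> real"
  assumes pos: "\<And>x n. 0 < n \<Longrightarrow> 0 \<le> form4 c1 c2 c3 c4 c5 x 1 (1 / sqrt (real n)) (1 / real n)"
    and A: "finite A"
  shows "0 \<le> form4 c1 c2 c3 c4 c5 (\<Sum>i\<in>A. y i) (\<Sum>i\<in>A. (y i)\<^sup>2) (\<Sum>i\<in>A. y i ^ 3) (\<Sum>i\<in>A. y i ^ 4)"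
proof (cases "\<forall>i\<in>A. y i = 0")
  case True
  then show ?thesis by (simp add: form4_def)
next
  case False
  define s where "s = sqrt (\<Sum>i\<in>A. (y i)\<^sup>2)"
  define z where "z = (\<lambda>i. y i / s)"
  have "0 < (\<Sum>i\<in>A. (y i)\<^sup>2)"
    using False A by (auto intro!: sum_pos2)
  then have s: "s > 0" "s\<^sup>2 = (\<Sum>i\<in>A. (y i)\<^sup>2)" by (auto simp: s_def)
  have y: "y i = s * z i" for i using s by (simp add: z_def)
  have "(\<Sum>i\<in>A. (z i)\<^sup>2) = 1"
    using s(1) by (simp add: z_def power_divide flip: sum_divide_distrib s(2))
  then have "0 \<le> s ^ 4 * form4 c1 c2 c3 c4 c5 (\<Sum>i\<in>A. z i) (\<Sum>i\<in>A. (z i)\<^sup>2) (\<Sum>i\<in>A. z i ^ 3) (\<Sum>i\<in>A. z i ^ 4)"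
    using form4_nonneg_sphere[OF pos A, of z] by simp
  then show ?thesis
    unfolding form4_scale[symmetric] y by (simp add: power_mult_distrib sum_distrib_left)
qed

lemma sum_two_blocks:
  fixes F :: "real \<Rightarrow> real"
  shows "(\<Sum>i\<in>{1..n+m}. F (if i \<le> n then a else t)) = real n * F a + real m * F t"
proof -
  have "(\<Sum>i\<in>{1..n+m}. F (if i \<le> n then a else t)) =
      (\<Sum>i\<in>{1..n}. F a) + (\<Sum>i\<in>{n+1..n+m}. F t)"
    by (subst sum.ub_add_nat) (auto intro!: arg_cong2[where f = plus] sum.cong)
  then show ?thesis by simp
qed

lemma form4_nonneg_power_mean_points:
  assumes pos: "\<And>(n::nat) y. 0 \<le> form4 c1 c2 c3 c4 c5
      (\<Sum>i\<in>{1..n}. y i) (\<Sum>i\<in>{1..n}. (y i)\<^sup>2) (\<Sum>i\<in>{1..n}. y i ^ 3) (\<Sum>i\<in>{1..n}. y i ^ 4)"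
    and n: "0 < n"
  shows "0 \<le> form4 c1 c2 c3 c4 c5 x 1 (1 / sqrt (real n)) (1 / real n)"
proof -
  let ?F = "form4 c1 c2 c3 c4 c5"
  \<comment> \<open>The n coordinates \<open>a\<close> sum to sqrt n; the missing \<open>d\<close>
    is spread evenly over m further coordinates, whose higher power sums tend to 0 as m
    grows.\<close>
  define a d where "a = 1 / sqrt (real n)" and "d = x - sqrt (real n)"
  have a: "real n * a = sqrt (real n)" "real n * a\<^sup>2 = 1"
    using n by (auto simp: a_def power_divide field_simps real_sqrt_mult_self)
  have "real n * a ^ 3 = (real n * a\<^sup>2) * a" "real n * a ^ 4 = (real n * a\<^sup>2) * a\<^sup>2"
    by (simp_all add: power2_eq_square power3_eq_cube power4_eq_xxxx)
  then have a34: "real n * a ^ 3 = a" "real n * a ^ 4 = a\<^sup>2"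
    unfolding a by simp_all
  have "0 \<le> ?F x (1 + d\<^sup>2 / real m) (a + d ^ 3 / real m ^ 2) (a\<^sup>2 + d ^ 4 / real m ^ 3)"
    if "0 < m" for m
  proof -
    have t: "real m * (d / real m) = d" "real m * (d / real m)\<^sup>2 = d\<^sup>2 / real m"
      "real m * (d / real m) ^ 3 = d ^ 3 / real m ^ 2" "real m * (d / real m) ^ 4 = d ^ 4 / real m ^ 3"
      using that by (auto simp: field_simps power2_eq_square power3_eq_cube power4_eq_xxxx)
    show ?thesis
      using pos[where n = "n + m" and y = "\<lambda>i. if i \<le> n then a else d / real m"]
      unfolding sum_two_blocks[of "\<lambda>t. t"] sum_two_blocks[of "\<lambda>t. t\<^sup>2"]
        sum_two_blocks[of "\<lambda>t. t ^ 3"] sum_two_blocks[of "\<lambda>t. t ^ 4"] t a a34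
      by (simp add: d_def)
  qed
  moreover have "(\<lambda>m. ?F x (1 + d\<^sup>2 / real m) (a + d ^ 3 / real m ^ 2) (a\<^sup>2 + d ^ 4 / real m ^ 3))
      \<longlonglongrightarrow> ?F x (1 + 0) (a + 0) (a\<^sup>2 + 0)"
    unfolding form4_def by (intro tendsto_intros) real_asymp+
  ultimately have "0 \<le> ?F x (1 + 0) (a + 0) (a\<^sup>2 + 0)"
    by (intro tendsto_lowerbound) (auto intro!: eventually_sequentiallyI[of 1])
  then show ?thesis using n by (simp add: a_def power_divide)
qed

section \<open>Explicit sums of squares\<close>

lemma vars_add: "vars (p + q) \<subseteq> vars p \<union> vars q"
  using keys_add[of p q] by (auto simp: vars_def)

lemma vars_mult: "vars (p * q) \<subseteq> vars p \<union> vars q"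
proof
  fix i assume "i \<in> vars (p * q)"
  then obtain m where "m \<in> Poly_Mapping.keys (p * q)" "i \<in> Poly_Mapping.keys m"
    by (auto simp: vars_def)
  then obtain m1 m2 where "m1 \<in> Poly_Mapping.keys p" "m2 \<in> Poly_Mapping.keys q"
    "i \<in> Poly_Mapping.keys (m1 + m2)"
    using keys_mult[of p q] by blast
  then show "i \<in> vars p \<union> vars q"
    using keys_add[of m1 m2] by (auto simp: vars_def)
qed

lemma vars_Const [simp]: "vars (Const c) = {}"
  by (simp add: vars_def Const_def)

lemma vars_one [simp]: "vars 1 = {}"
  by (simp add: vars_def)

lemma vars_Var [simp]: "vars (Var i) = {i}"
  by (simp add: vars_def Var_def)

definition poly_in :: "nat \<Rightarrow> rpoly \<Rightarrow> bool" where
  "poly_in n p \<longleftrightarrow> vars p \<subseteq> {1..n}"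

lemma poly_in_add: "poly_in n p \<Longrightarrow> poly_in n q \<Longrightarrow> poly_in n (p + q)"
  using vars_add[of p q] by (auto simp: poly_in_def)

lemma poly_in_mult: "poly_in n p \<Longrightarrow> poly_in n q \<Longrightarrow> poly_in n (p * q)"
  using vars_mult[of p q] by (auto simp: poly_in_def)

lemma poly_in_zero: "poly_in n 0"
  by (simp add: poly_in_def vars_def)

lemma poly_in_one: "poly_in n 1"
  by (simp add: poly_in_def)

lemma poly_in_Const: "poly_in n (Const c)"
  by (simp add: poly_in_def)

lemma poly_in_Var: "i \<in> {1..n} \<Longrightarrow> poly_in n (Var i)"
  by (simp add: poly_in_def)

lemma poly_in_power: "poly_in n p \<Longrightarrow> poly_in n (p ^ k)"
  by (induction k) (auto intro: poly_in_mult poly_in_one)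

lemma poly_in_sum: "(\<And>i. i \<in> I \<Longrightarrow> poly_in n (g i)) \<Longrightarrow> poly_in n (\<Sum>i\<in>I. g i)"
  by (induction I rule: infinite_finite_induct) (auto intro: poly_in_add poly_in_zero)

lemma poly_in_power_sum: "poly_in n (power_sum n k)"
  unfolding power_sum_def by (intro poly_in_sum poly_in_power poly_in_Var)

lemmas poly_in_intros = poly_in_add poly_in_mult poly_in_Const poly_in_Var poly_in_power poly_in_power_sum

lemma sos_poly_square: "poly_in n q \<Longrightarrow> sos_poly n (q ^ 2)"
  unfolding sos_poly_def poly_in_def by (rule exI[of _ "[q]"]) simp

lemma sos_poly_zero: "sos_poly n 0"
  unfolding sos_poly_def by (rule exI[of _ "[]"]) simp

lemma sos_poly_add: "sos_poly n p \<Longrightarrow> sos_poly n q \<Longrightarrow> sos_poly n (p + q)"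
  unfolding sos_poly_def by (elim exE, rule_tac x = "qs @ qsa" in exI) auto

lemma sos_poly_sum: "(\<And>i. i \<in> I \<Longrightarrow> sos_poly n (g i)) \<Longrightarrow> sos_poly n (\<Sum>i\<in>I. g i)"
  by (induction I rule: infinite_finite_induct) (auto intro: sos_poly_add sos_poly_zero)

lemma sos_poly_square_mult:
  assumes "poly_in n q" "sos_poly n p"
  shows "sos_poly n (q ^ 2 * p)"
proof -
  obtain qs where "\<forall>r\<in>set qs. poly_in n r" "p = (\<Sum>r\<leftarrow>qs. r ^ 2)"
    using assms(2) by (auto simp: sos_poly_def poly_in_def)
  then show ?thesis
    using assms(1)
    by (induction qs arbitrary: p)
      (auto intro!: sos_poly_add sos_poly_zero sos_poly_square poly_in_mult
        simp: algebra_simps simp flip: power_mult_distrib)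
qed

lemma Const_hom: "Const (a + b) = Const a + Const b" "Const (a * b) = Const a * Const b"
  "Const (a - b) = Const a - Const b" "Const (a ^ k) = Const a ^ k" "Const 0 = 0" "Const 1 = 1"
proof -
  show "Const (a + b) = Const a + Const b" "Const (a * b) = Const a * Const b"
    "Const 0 = 0" "Const 1 = 1"
    by (rule const.add const.mult const.zero const.one)+
  show "Const (a - b) = Const a - Const b"
    using const.add[of "a - b" b] by simp
  show "Const (a ^ k) = Const a ^ k"
    by (induction k) (auto simp: const.mult const.one)
qed

lemma Const_numeral: "Const (numeral k) = numeral k"
  by (simp add: Const_def)

lemma sos_poly_scale:
  assumes "0 \<le> c" "sos_poly n p"
  shows "sos_poly n (Const c * p)"
proof -
  have "Const c = Const (sqrt c) ^ 2"
    using assms(1) by (simp flip: Const_hom)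
  then show ?thesis using sos_poly_square_mult[OF poly_in_Const assms(2)] by simp
qed

lemma sos_poly_power_sum2: "sos_poly n (power_sum n 2)"
  unfolding power_sum_def by (intro sos_poly_sum sos_poly_square poly_in_Var)

text \<open>The difference is the sum of (X_i X_j)^2 over ordered pairs of distinct indices.\<close>

lemma sos_poly_power_sum2_square_minus: "sos_poly n (power_sum n 2 ^ 2 - power_sum n 4)"
proof -
  have "(\<Sum>j\<in>{1..n} - {i}. (Var i * Var j) ^ 2) = Var i ^ 2 * power_sum n 2 - Var i ^ 4"
    if "i \<in> {1..n}" for i
    using that by (simp add: sum_diff1 power_sum_def power_mult_distrib sum_distrib_left algebra_simps)
  then have "(\<Sum>i\<in>{1..n}. \<Sum>j\<in>{1..n} - {i}. (Var i * Var j) ^ 2) =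
      (\<Sum>i\<in>{1..n}. Var i ^ 2 * power_sum n 2 - Var i ^ 4)"
    by (intro sum.cong) auto
  also have "\<dots> = power_sum n 2 ^ 2 - power_sum n 4"
    by (simp add: sum_subtractf power2_eq_square[of "power_sum n 2"] sum_distrib_right[symmetric])
      (simp add: power_sum_def)
  finally show ?thesis
    by (metis (no_types, lifting) DiffD1 poly_in_Var poly_in_mult sos_poly_square sos_poly_sum)
qed

text \<open>The three inequalities give a certificate of nonnegativity for X >= 0: A X^2 + B X + C =
  (sqrt A X - sqrt C)^2 + (B + 2 sqrt A sqrt C) X.\<close>

lemma copositive_quadratic:
  fixes A B C :: real
  assumes pos: "\<And>X. 0 \<le> X \<Longrightarrow> 0 \<le> A * X\<^sup>2 + B * X + C"
  shows "0 \<le> A" "0 \<le> C" "0 \<le> B + 2 * (sqrt A * sqrt C)"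
proof -
  show C: "0 \<le> C" using pos[of 0] by simp
  show A: "0 \<le> A"
  proof (rule ccontr)
    assume neg: "\<not> 0 \<le> A"
    \<comment> \<open>With this X, A X + |B| + C equals A, which is negative, while X >= 1 bounds B
      X + C by (|B| + C) X.\<close>
    define X where "X = 1 + (\<bar>B\<bar> + C) / (- A)"
    have X: "1 \<le> X" using neg C by (simp add: X_def divide_nonneg_neg)
    have "A * X = A - (\<bar>B\<bar> + C)" using neg by (simp add: X_def field_simps)
    then have "A * X + \<bar>B\<bar> + C < 0" using neg by simp
    then have "(A * X + \<bar>B\<bar> + C) * X < 0" using X by (intro mult_neg_pos) auto
    moreover have "B * X \<le> \<bar>B\<bar> * X" "C * 1 \<le> C * X"
      using X C by (auto intro!: mult_right_mono mult_left_mono simp: mult_le_cancel_left1)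
    ultimately have "A * X\<^sup>2 + B * X + C < 0" by (simp add: algebra_simps power2_eq_square)
    then show False using pos[of X] X by simp
  qed
  show "0 \<le> B + 2 * (sqrt A * sqrt C)"
  proof (cases "0 \<le> B")
    case True
    then show ?thesis using A C by simp
  next
    case B: False
    show ?thesis
    proof (cases "A = 0")
      case True
      have "B * ((C + 1) / (- B)) = - (C + 1)" using B by simp
      then have "A * ((C + 1) / (- B))\<^sup>2 + B * ((C + 1) / (- B)) + C < 0" using True by simp
      moreover have "0 \<le> A * ((C + 1) / (- B))\<^sup>2 + B * ((C + 1) / (- B)) + C"
        using B C by (intro pos divide_nonneg_pos) auto
      ultimately show ?thesis by linarith
    next
      case False
      \<comment> \<open>The value at the vertex of the parabola gives the discriminant
        condition.\<close>
      have "0 \<le> A * (- B / (2 * A))\<^sup>2 + B * (- B / (2 * A)) + C"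
        using A B False by (intro pos) (simp add: divide_nonpos_pos)
      also have "\<dots> = C - B\<^sup>2 / (4 * A)"
        using False by (simp add: field_simps power2_eq_square)
      finally have "(- B)\<^sup>2 \<le> (2 * (sqrt A * sqrt C))\<^sup>2"
        using A C False by (simp add: field_simps power_mult_distrib)
      then have "- B \<le> 2 * (sqrt A * sqrt C)"
        by (rule power2_le_imp_le) (use A C in auto)
      then show ?thesis by simp
    qed
  qed
qed

text \<open>Homogenizes the certificate of \<open>copositive_quadratic\<close>: a square plus a
  nonnegative multiple of p^2 q, which is a sum of squares because q is one.\<close>

lemma sos_poly_copositive:
  assumes "\<And>X. 0 \<le> X \<Longrightarrow> 0 \<le> A * X\<^sup>2 + B * X + C"
    and p: "poly_in n p" and q: "poly_in n q" "sos_poly n q"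
  shows "sos_poly n (Const A * p ^ 4 + Const B * p ^ 2 * q + Const C * q ^ 2)"
proof -
  let ?a = "Const (sqrt A)" and ?c = "Const (sqrt C)"
  let ?B = "B + 2 * (sqrt A * sqrt C)"
  note cop = copositive_quadratic[OF assms(1), simplified]
  have eq: "Const A = ?a ^ 2" "Const C = ?c ^ 2" "Const B = Const ?B - 2 * ?a * ?c"
    using cop by (simp_all flip: Const_hom) (simp add: Const_hom Const_numeral)
  have minus_one: "Const (- 1) = - 1"
    using Const_hom(3)[of 0 1] by (simp add: Const_hom)
  have "Const A * p ^ 4 + Const B * p ^ 2 * q + Const C * q ^ 2 =
      (?a * p ^ 2 + Const (- 1) * (?c * q)) ^ 2 + Const ?B * (p ^ 2 * q)"
    unfolding eq minus_one by (simp add: power2_eq_square power4_eq_xxxx algebra_simps)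
  also have "sos_poly n \<dots>"
    using cop p q
    by (intro sos_poly_add sos_poly_square sos_poly_scale sos_poly_square_mult poly_in_intros) auto
  finally show ?thesis .
qed

text \<open>Such y is a critical point of c1 y^4 + c2 y^2 - c y. The left side of the equation is 0
  at 0 and at least c at some large y, so the intermediate value theorem applies.\<close>

lemma exists_cubic_root:
  fixes c1 c2 c :: real
  assumes c: "0 < c" and c12: "0 < c1 \<or> c1 = 0 \<and> 0 < c2"
  obtains y where "0 < y" "4 * c1 * y ^ 3 + 2 * c2 * y = c"
proof (cases "c1 = 0")
  case True
  then show ?thesis using assms by (intro that[of "c / (2 * c2)"]) auto
next
  case False
  then have c1: "0 < c1" using c12 by auto
  define M where "M = 1 + (c + 2 * \<bar>c2\<bar>) / (4 * c1)"
  have M: "1 \<le> M" using c c1 by (simp add: M_def)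
  have "4 * c1 * M = 4 * c1 + c + 2 * \<bar>c2\<bar>" using c1 by (simp add: M_def field_simps)
  then have "c + 2 * \<bar>c2\<bar> \<le> 4 * c1 * M" using c1 by simp
  then have "(c + 2 * \<bar>c2\<bar>) * M\<^sup>2 \<le> 4 * c1 * M * M\<^sup>2" by (intro mult_right_mono) auto
  moreover have "- c2 * M \<le> \<bar>c2\<bar> * M\<^sup>2"
    using M by (intro mult_mono) (auto simp: power2_eq_square)
  moreover have "c * 1 \<le> c * M\<^sup>2" using M c by (intro mult_left_mono) auto
  ultimately have "c \<le> 4 * c1 * M ^ 3 + 2 * c2 * M"
    by (simp add: algebra_simps power2_eq_square power3_eq_cube)
  then have "\<exists>y\<ge>0. y \<le> M \<and> 4 * c1 * y ^ 3 + 2 * c2 * y = c"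
    using c M by (intro IVT') (auto intro!: continuous_intros)
  then show ?thesis using that c by (metis mult_zero_right order_le_less power_zero_numeral add_0)
qed

text \<open>With X = x^2 and the worse sign of x, the hypothesis says that c1 X^2 + c2 X + c4 + c5
  is at least the maximum over u of |c3| u sqrt X + c5 (1 - u^2), a concave function of X. If c3 is
  nonzero, \<open>2 * w * e = c3\<close> makes the line w + w e^2 X tangent to |c3| sqrt X, and w >=
  c5 keeps it above the whole concave function.\<close>

lemma exists_separating_line:
  fixes c1 c2 c3 c4 c5 :: real
  assumes pos: "\<And>x u. 0 \<le> u \<Longrightarrow> u \<le> 1 \<Longrightarrow> 0 \<le> form4 c1 c2 c3 c4 c5 x 1 u (u\<^sup>2)"
  obtains w e where "0 \<le> w" "c5 \<le> w" "2 * w * e = c3"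
    "\<And>X. 0 \<le> X \<Longrightarrow> 0 \<le> c1 * X\<^sup>2 + (c2 - w * e\<^sup>2) * X + (c4 + c5 - w)"
proof -
  define c where "c = \<bar>c3\<bar>"
  have H: "0 \<le> c1 * X\<^sup>2 + c2 * X - c * u * sqrt X + c4 + c5 * u\<^sup>2"
    if "0 \<le> u" "u \<le> 1" "0 \<le> X" for u X
  proof -
    have "sqrt X ^ 4 = X\<^sup>2" "(sqrt X)\<^sup>2 = X"
      using that(3) by (simp_all add: power4_eq_xxxx power2_eq_square)
    then show ?thesis
      using pos[OF that(1,2), of "sqrt X"] pos[OF that(1,2), of "- sqrt X"]
      by (cases "0 \<le> c3") (auto simp: form4_def c_def algebra_simps)
  qed
  show ?thesis
  proof (cases "c3 = 0")
    case True
    \<comment> \<open>With e = 0 the line is constant; the extreme u is 0 if c5 >= 0 and 1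
      otherwise.\<close>
    show ?thesis
    proof (cases "0 \<le> c5")
      case c5: True
      have "0 \<le> c1 * X\<^sup>2 + c2 * X + c4" if "0 \<le> X" for X
        using H[of 0 X] that by simp
      then show ?thesis using True c5 by (intro that[of c5 0]) auto
    next
      case False
      have "0 \<le> c1 * X\<^sup>2 + c2 * X + (c4 + c5)" if "0 \<le> X" for X
        using H[of 1 X] that True by (simp add: c_def)
      then show ?thesis using True False by (intro that[of 0 0]) auto
    qed
  next
    case False
    then have c: "0 < c" "c\<^sup>2 = c3\<^sup>2" by (auto simp: c_def)
    have "0 \<le> c1 * X\<^sup>2 + c2 * X + c4" if "0 \<le> X" for X using H[of 0 X] that by simp
    note cop = copositive_quadratic[OF this, simplified]
    \<comment> \<open>With c1 = c2 = 0 the term -c sqrt X would be unbounded below.\<close>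
    have "0 < c1 \<or> c1 = 0 \<and> 0 < c2"
    proof (rule ccontr)
      assume "\<not> ?thesis"
      then have "c1 = 0" "c2 = 0" using cop by auto
      then show False
        using H[of 1 "((\<bar>c4 + c5\<bar> + 1) / c)\<^sup>2"] c by simp
    qed
    then obtain y where y: "0 < y" "4 * c1 * y ^ 3 + 2 * c2 * y = c"
      using exists_cubic_root[OF c(1)] by blast
    \<comment> \<open>The critical point equation: at X = y^2 the slope of c sqrt X equals that of
      c1 X^2 + c2 X.\<close>
    then have cy: "c / (2 * y) = 2 * c1 * y\<^sup>2 + c2"
      by (simp add: field_simps power2_eq_square power3_eq_cube)
    show ?thesis
    proof (cases "c5 \<le> c * y / 2")
      case True
      \<comment> \<open>The parabola minus \<open>c * sqrt X\<close> is minimal at \<open>y\<^sup>2\<close>; take the tangent there.\<close>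
      define w where "w = c * y / 2"
      have w: "0 < w" using c y by (simp add: w_def)
      have "w * (c3 / (2 * w))\<^sup>2 = c\<^sup>2 / (4 * w)"
        using w c by (simp add: field_simps power2_eq_square)
      also have "\<dots> = c / (2 * y)" using c y by (simp add: w_def field_simps power2_eq_square)
      finally have we: "w * (c3 / (2 * w))\<^sup>2 = 2 * c1 * y\<^sup>2 + c2" using cy by simp
      have wy: "w = 2 * (c1 * y ^ 4) + c2 * y\<^sup>2"
        unfolding w_def y(2)[symmetric]
        by (simp add: field_simps power2_eq_square power3_eq_cube power4_eq_xxxx)
      have "0 \<le> c1 * y ^ 4 + c2 * y\<^sup>2 - c * y + c4 + c5"
        using H[of 1 "y\<^sup>2"] y by (simp flip: power_mult)
      then have at_y: "0 \<le> c4 + c5 - c1 * y ^ 4 - w"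
        using wy by (simp add: w_def)
      have "0 \<le> c1 * X\<^sup>2 + (c2 - w * (c3 / (2 * w))\<^sup>2) * X + (c4 + c5 - w)" if "0 \<le> X" for X
      proof -
        \<comment> \<open>Since w e^2 is the slope at y^2, subtracting the line leaves c1 (X -
          y^2)^2 plus a constant.\<close>
        have "0 \<le> c1 * (X - y\<^sup>2)\<^sup>2 + (c4 + c5 - c1 * y ^ 4 - w)"
          using cop at_y by (intro add_nonneg_nonneg mult_nonneg_nonneg) auto
        then show ?thesis
          unfolding we by (simp add: algebra_simps power2_eq_square power4_eq_xxxx)
      qed
      from that[OF _ _ _ this] show ?thesis using w True[folded w_def] by simp
    next
      case False
      then have c5: "0 < c5" "c * y / 2 < c5" using c y mult_pos_pos[of c y] by linarith+
      \<comment> \<open>For \<open>X \<le> z\<^sup>2\<close> the line is attained on the curve at \<open>u = sqrt X / z\<close>; beyond \<open>z\<^sup>2 > y\<^sup>2\<close> the difference increases.\<close>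
      define z where "z = 2 * c5 / c"
      have z: "0 < z" "y < z" using c5 c by (auto simp: z_def field_simps)
      have we: "c5 * (c3 / (2 * c5))\<^sup>2 = c / (2 * z)"
        using c5 c by (simp add: z_def field_simps power2_eq_square)
      have small: "0 \<le> c1 * X\<^sup>2 + (c2 - c / (2 * z)) * X + c4" if "0 \<le> X" "X \<le> z\<^sup>2" for X
      proof -
        have "sqrt X \<le> z" using that z by (simp add: real_le_lsqrt)
        then have "0 \<le> c1 * X\<^sup>2 + c2 * X - c * (sqrt X / z) * sqrt X + c4 + c5 * (sqrt X / z)\<^sup>2"
          using z that by (intro H) auto
        also have "c * (sqrt X / z) * sqrt X = c / z * X" using that by simp
        also have "c5 = c * z / 2" using c by (simp add: z_def)
        also have "c * z / 2 * (sqrt X / z)\<^sup>2 = c / (2 * z) * X"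
          using that z by (simp add: power_divide power2_eq_square)
        finally show ?thesis by (simp add: algebra_simps)
      qed
      have line: "0 \<le> c1 * X\<^sup>2 + (c2 - c / (2 * z)) * X + c4" if "0 \<le> X" for X
      proof (cases "X \<le> z\<^sup>2")
        case True
        then show ?thesis using small that by simp
      next
        case False
        have "c / (2 * z) \<le> c / (2 * y)" using c y z by (intro divide_left_mono) auto
        moreover have "c1 * y\<^sup>2 \<le> c1 * z\<^sup>2" "c1 * z\<^sup>2 \<le> c1 * X"
          using cop y z False by (auto intro!: mult_left_mono power_mono)
        ultimately have "0 \<le> c1 * (X + z\<^sup>2) + (c2 - c / (2 * z))"
          unfolding cy by (simp add: algebra_simps)
        then have "0 \<le> (X - z\<^sup>2) * (c1 * (X + z\<^sup>2) + (c2 - c / (2 * z)))"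
          using False by simp
        moreover have "0 \<le> c1 * (z\<^sup>2)\<^sup>2 + (c2 - c / (2 * z)) * z\<^sup>2 + c4" by (intro small) auto
        moreover have "c1 * X\<^sup>2 + K * X + c4 =
            (X - z\<^sup>2) * (c1 * (X + z\<^sup>2) + K) + (c1 * (z\<^sup>2)\<^sup>2 + K * z\<^sup>2 + c4)" for K
          by algebra
        ultimately show ?thesis by simp
      qed
      have "0 \<le> c1 * X\<^sup>2 + (c2 - c5 * (c3 / (2 * c5))\<^sup>2) * X + (c4 + c5 - c5)" if "0 \<le> X" for X
        unfolding we using line[OF that] by simp
      from that[OF _ _ _ this] show ?thesis using c5 by simp
    qed
  qed
qed

lemma sos_form4:
  assumes pos: "\<And>x u. 0 \<le> u \<Longrightarrow> u \<le> 1 \<Longrightarrow> 0 \<le> form4 c1 c2 c3 c4 c5 x 1 u (u\<^sup>2)"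
  shows "sos_poly n (Const c1 * power_sum n 1 ^ 4 + Const c2 * power_sum n 2 * power_sum n 1 ^ 2
     + Const c3 * power_sum n 3 * power_sum n 1 + Const c4 * power_sum n 2 ^ 2
     + Const c5 * power_sum n 4)"
proof -
  obtain w e where w: "0 \<le> w" "c5 \<le> w" "2 * w * e = c3"
    and cop: "\<And>X. 0 \<le> X \<Longrightarrow> 0 \<le> c1 * X\<^sup>2 + (c2 - w * e\<^sup>2) * X + (c4 + c5 - w)"
    using exists_separating_line[OF pos] by blast
  let ?p1 = "power_sum n 1" and ?p2 = "power_sum n 2" and ?p3 = "power_sum n 3" and ?p4 = "power_sum n 4"
  have sq: "(\<Sum>i\<in>{1..n}. (Var i ^ 2 + Const e * ?p1 * Var i) ^ 2) =
      ?p4 + 2 * Const e * ?p1 * ?p3 + Const e ^ 2 * ?p1 ^ 2 * ?p2"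
    unfolding power_sum_def[of n 2] power_sum_def[of n 3] power_sum_def[of n 4]
      sum_distrib_left sum.distrib[symmetric]
    by (intro sum.cong refl) (simp add: algebra_simps power2_eq_square power3_eq_cube power4_eq_xxxx)
  have c3: "Const c3 = 2 * Const w * Const e"
    unfolding w(3)[symmetric] by (simp add: Const_hom Const_numeral)
  have "Const c1 * ?p1 ^ 4 + Const c2 * ?p2 * ?p1 ^ 2 + Const c3 * ?p3 * ?p1 + Const c4 * ?p2 ^ 2
      + Const c5 * ?p4 =
    (Const c1 * ?p1 ^ 4 + Const (c2 - w * e\<^sup>2) * ?p1 ^ 2 * ?p2 + Const (c4 + c5 - w) * ?p2 ^ 2)
    + Const w * (\<Sum>i\<in>{1..n}. (Var i ^ 2 + Const e * ?p1 * Var i) ^ 2)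
    + Const (w - c5) * (?p2 ^ 2 - ?p4)"
    unfolding sq c3 by (simp add: Const_hom algebra_simps)
  also have "sos_poly n \<dots>"
  proof (rule sos_poly_add[OF sos_poly_add])
    show "sos_poly n (Const c1 * ?p1 ^ 4 + Const (c2 - w * e\<^sup>2) * ?p1 ^ 2 * ?p2
        + Const (c4 + c5 - w) * ?p2 ^ 2)"
      by (rule sos_poly_copositive[OF cop poly_in_power_sum poly_in_power_sum sos_poly_power_sum2])
    have "poly_in n (Var i ^ 2 + Const e * ?p1 * Var i)" if "i \<in> {1..n}" for i
      using that by (intro poly_in_intros)
    then show "sos_poly n (Const w * (\<Sum>i\<in>{1..n}. (Var i ^ 2 + Const e * ?p1 * Var i) ^ 2))"
      by (intro sos_poly_scale w(1) sos_poly_sum sos_poly_square)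
    show "sos_poly n (Const (w - c5) * (?p2 ^ 2 - ?p4))"
      using w(2) by (intro sos_poly_scale sos_poly_power_sum2_square_minus) simp
  qed
  finally show ?thesis .
qed

section \<open>Quadratic forms and the signed average\<close>

text \<open>The index set consists of exponent vectors, so the degree 2 part of a polynomial has
  this shape directly: \<open>i m\<close> and \<open>j m\<close> are the two, possibly equal,
  variables of the monomial \<open>m\<close>.\<close>

definition quadratic_form :: "((nat \<Rightarrow> real) \<Rightarrow> real) \<Rightarrow> bool" where
  "quadratic_form Q \<longleftrightarrow> (\<exists>(M :: (nat \<Rightarrow>\<^sub>0 nat) set) c i j. finite M \<and> Q = (\<lambda>x. \<Sum>m\<in>M. c m * x (i m) * x (j m)))"

lemma monomial_peel:
  fixes d :: "'a \<Rightarrow> nat"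
  assumes "finite K" "(\<Sum>k\<in>K. d k) = Suc n"
  shows "\<exists>i d'. (\<Sum>k\<in>K. d' k) = n \<and>
    (\<forall>x :: 'a \<Rightarrow> real. (\<Prod>k\<in>K. x k ^ d k) = x i * (\<Prod>k\<in>K. x k ^ d' k))"
proof -
  obtain i where i: "i \<in> K" "0 < d i"
    using assms by (metis gr0I sum.neutral Suc_neq_Zero)
  let ?d = "d(i := d i - 1)"
  have "(\<Sum>k\<in>K. ?d k) = n"
    using assms i by (simp add: sum.remove[OF assms(1) i(1)])
  moreover have "(\<Prod>k\<in>K. x k ^ d k) = x i * (\<Prod>k\<in>K. x k ^ ?d k)" for x :: "'a \<Rightarrow> real"
  proof -
    have "(\<Prod>k\<in>K. x k ^ ?d k) = x i ^ (d i - 1) * (\<Prod>k\<in>K - {i}. x k ^ d k)"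
      by (subst prod.remove[OF assms(1) i(1)]) simp
    moreover have "x i * x i ^ (d i - 1) = x i ^ d i"
      using i(2) by (simp flip: power_Suc)
    ultimately show ?thesis
      by (subst prod.remove[OF assms(1) i(1)]) (simp flip: mult.assoc)
  qed
  ultimately show ?thesis by blast
qed

lemma monomial_degree_two:
  fixes d :: "'a \<Rightarrow> nat"
  assumes "finite K" "(\<Sum>k\<in>K. d k) = 2"
  shows "\<exists>i j. \<forall>x :: 'a \<Rightarrow> real. (\<Prod>k\<in>K. x k ^ d k) = x i * x j"
proof -
  have "(\<Sum>k\<in>K. d k) = Suc (Suc 0)" using assms by simp
  from monomial_peel[OF assms(1) this] obtain i d' where
    d': "(\<Sum>k\<in>K. d' k) = Suc 0"
    "\<forall>x :: 'a \<Rightarrow> real. (\<Prod>k\<in>K. x k ^ d k) = x i * (\<Prod>k\<in>K. x k ^ d' k)" by blast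
  from monomial_peel[OF assms(1) d'(1)] obtain j d'' where
    d'': "(\<Sum>k\<in>K. d'' k) = 0"
    "\<forall>x :: 'a \<Rightarrow> real. (\<Prod>k\<in>K. x k ^ d' k) = x j * (\<Prod>k\<in>K. x k ^ d'' k)" by blast
  have "(\<Prod>k\<in>K. x k ^ d'' k) = 1" for x :: "'a \<Rightarrow> real"
    using d''(1) assms(1) by simp
  with d' d'' show ?thesis by auto
qed

lemma prod_monom_power:
  "(\<Prod>k\<in>K. monom (x k :: real) 1 ^ d k) = monom (\<Prod>k\<in>K. x k ^ d k) (\<Sum>k\<in>K. d k)"
  by (induction K rule: infinite_finite_induct) (auto simp: monom_power mult_monom)

text \<open>The value of \<open>q\<close> at \<open>t x\<close> as a polynomial in \<open>t\<close>: its coefficients are the homogeneous parts of \<open>q\<close> at \<open>x\<close>.\<close>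

definition along_ray :: "(nat \<Rightarrow> real) \<Rightarrow> rpoly \<Rightarrow> real poly" where
  "along_ray x q = subst_poly (\<lambda>c. [:c:]) (\<lambda>i. monom (x i) 1) q"

lemma quadratic_form_coeff_along_ray: "quadratic_form (\<lambda>x. coeff (along_ray x q) 2)"
proof -
  let ?deg = "\<lambda>m. \<Sum>k\<in>Poly_Mapping.keys m. Poly_Mapping.lookup m k"
  let ?mon = "\<lambda>x m. \<Prod>k\<in>Poly_Mapping.keys m. x k ^ Poly_Mapping.lookup m k"
  define M where "M = {m \<in> Poly_Mapping.keys q. ?deg m = 2}"
  have "\<forall>m\<in>M. \<exists>i j. \<forall>x :: nat \<Rightarrow> real. ?mon x m = x i * x j"
    by (auto simp: M_def intro!: monomial_degree_two)
  then obtain i j where ij: "\<And>m x. m \<in> M \<Longrightarrow> ?mon x m = (x (i m) * x (j m) :: real)"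
    by metis
  have "coeff (along_ray x q) 2 = (\<Sum>m\<in>M. Poly_Mapping.lookup q m * x (i m) * x (j m))" for x
  proof -
    have "coeff (along_ray x q) 2 =
        (\<Sum>m\<in>Poly_Mapping.keys q. if ?deg m = 2 then Poly_Mapping.lookup q m * ?mon x m else 0)"
      unfolding along_ray_def subst_poly_def prod_monom_power
      by (auto simp: coeff_sum intro!: sum.cong)
    also have "\<dots> = (\<Sum>m\<in>M. Poly_Mapping.lookup q m * ?mon x m)"
      unfolding M_def by (simp add: sum.inter_filter)
    also have "\<dots> = (\<Sum>m\<in>M. Poly_Mapping.lookup q m * x (i m) * x (j m))"
      by (intro sum.cong) (auto simp: ij)
    finally show ?thesis .
  qed
  moreover have "finite M" by (simp add: M_def)
  ultimately show ?thesis unfolding quadratic_form_def by blast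
qed

text \<open>Squares cannot cancel: comparing coefficients of t^0 and then of t^2 shows that every
  \<open>p l\<close> starts at degree 2, so only the squares of the degree 2 coefficients contribute
  to t^4.\<close>

lemma sum_squares_eq_monom4:
  fixes p :: "'a \<Rightarrow> real poly"
  assumes "finite L" and eq: "(\<Sum>l\<in>L. p l ^ 2) = monom C 4"
  shows "C = (\<Sum>l\<in>L. (coeff (p l) 2)\<^sup>2)"
proof -
  note expand = power2_eq_square coeff_mult numeral_eq_Suc
  have co: "(\<Sum>l\<in>L. coeff (p l ^ 2) k) = coeff (monom C 4) k" for k
    unfolding eq[symmetric] by (simp add: coeff_sum)
  have "(\<Sum>l\<in>L. (coeff (p l) 0)\<^sup>2) = 0"
    using co[of 0] by (simp add: power2_eq_square coeff_mult)
  then have c0: "coeff (p l) 0 = 0" if "l \<in> L" for l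
    using that assms(1) by (simp add: sum_nonneg_eq_0_iff)
  have "(\<Sum>l\<in>L. coeff (p l ^ 2) 2) = (\<Sum>l\<in>L. (coeff (p l) 1)\<^sup>2)"
    by (intro sum.cong refl) (simp add: c0 expand)
  then have c1: "coeff (p l) 1 = 0" if "l \<in> L" for l
    using that assms(1) co[of 2] by (simp add: sum_nonneg_eq_0_iff)
  have "(\<Sum>l\<in>L. coeff (p l ^ 2) 4) = (\<Sum>l\<in>L. (coeff (p l) 2)\<^sup>2)"
    using c1 by (intro sum.cong refl) (simp add: c0 expand)
  then show ?thesis using co[of 4] by simp
qed

text \<open>Each polynomial in the decomposition is replaced by its degree 2 part, by comparing
  coefficients along every ray.\<close>

lemma sos_in_variables_quadratic_forms:
  assumes f: "f = Const c1 * Var 1 ^ 4 + Const c2 * Var 2 * Var 1 ^ 2 + Const c3 * Var 3 * Var 1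
                + Const c4 * Var 2 ^ 2 + Const c5 * Var 4"
    and sos: "sos_poly n (in_variables n f)"
  obtains L :: nat and Q where "\<And>l. quadratic_form (Q l)"
    "\<And>x. eval_poly (in_variables n f) x = (\<Sum>l<L. (Q l x)\<^sup>2)"
proof -
  obtain qs where qs: "in_variables n f = (\<Sum>q\<leftarrow>qs. q ^ 2)"
    using sos by (auto simp: sos_poly_def)
  have "eval_poly (in_variables n f) x = (\<Sum>l<length qs. (coeff (along_ray x (qs ! l)) 2)\<^sup>2)" for x
  proof (rule sum_squares_eq_monom4)
    have "monom (eval_poly (in_variables n f) x) 4 = along_ray x (\<Sum>q\<leftarrow>qs. q ^ 2)"
      unfolding qs[symmetric] along_ray_def by (rule subst_monom_in_variables[OF f, symmetric])
    also have "\<dots> = (\<Sum>q\<leftarrow>qs. along_ray x q ^ 2)"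
      by (simp add: along_ray_def)
    also have "\<dots> = (\<Sum>l<length qs. along_ray x (qs ! l) ^ 2)"
      by (simp add: sum_list_sum_nth atLeast0LessThan)
    finally show "(\<Sum>l<length qs. along_ray x (qs ! l) ^ 2) = monom (eval_poly (in_variables n f) x) 4" ..
  qed simp
  then show ?thesis
    by (rule that[rotated]) (rule quadratic_form_coeff_along_ray)
qed

section \<open>Quadratic functions and averages over signs\<close>

definition quadratic_on :: "nat set \<Rightarrow> ((nat \<Rightarrow> real) \<Rightarrow> real) \<Rightarrow> bool" where
  "quadratic_on I q \<longleftrightarrow> (\<exists>\<alpha> \<beta> \<gamma>. \<forall>z. q z =
     \<alpha> + (\<Sum>i\<in>I. \<beta> i * z i) + (\<Sum>i\<in>I. \<Sum>j\<in>I. \<gamma> i j * z i * z j))"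

text \<open>Prescribing the first power sum makes the extra coordinates affine functions of
  \<open>z\<close>, so quadratic forms turn into quadratic functions with lower order terms.\<close>

lemma quadratic_form_affine:
  assumes "quadratic_form Q"
  shows "quadratic_on I (\<lambda>z. Q (\<lambda>k. \<kappa> k + (\<Sum>i\<in>I. \<mu> k i * z i)))"
proof -
  obtain M :: "(nat \<Rightarrow>\<^sub>0 nat) set" and c s t where Q: "Q = (\<lambda>x. \<Sum>m\<in>M. c m * x (s m) * x (t m))"
    using assms by (auto simp: quadratic_form_def)
  define \<alpha> where "\<alpha> = (\<Sum>m\<in>M. c m * \<kappa> (s m) * \<kappa> (t m))"
  define \<beta> where "\<beta> = (\<lambda>i. \<Sum>m\<in>M. c m * (\<kappa> (s m) * \<mu> (t m) i + \<kappa> (t m) * \<mu> (s m) i))"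
  define \<gamma> where "\<gamma> = (\<lambda>i j. \<Sum>m\<in>M. c m * \<mu> (s m) i * \<mu> (t m) j)"
  have term_eq: "c * (k + (\<Sum>i\<in>I. a i * z i)) * (k' + (\<Sum>i\<in>I. a' i * z i)) =
      c * k * k' + (\<Sum>i\<in>I. c * (k * a' i + k' * a i) * z i)
      + (\<Sum>i\<in>I. \<Sum>j\<in>I. c * a i * a' j * z i * z j)" for c k k' :: real and a a' z
    by (simp add: algebra_simps sum.distrib sum_distrib_left sum_distrib_right)
  have "Q (\<lambda>k. \<kappa> k + (\<Sum>i\<in>I. \<mu> k i * z i)) =
      \<alpha> + (\<Sum>i\<in>I. \<beta> i * z i) + (\<Sum>i\<in>I. \<Sum>j\<in>I. \<gamma> i j * z i * z j)" for z
  proof -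
    have "(\<Sum>i\<in>I. \<beta> i * z i) =
        (\<Sum>m\<in>M. \<Sum>i\<in>I. c m * (\<kappa> (s m) * \<mu> (t m) i + \<kappa> (t m) * \<mu> (s m) i) * z i)"
      unfolding \<beta>_def sum_distrib_right by (rule sum.swap)
    moreover have "(\<Sum>i\<in>I. \<Sum>j\<in>I. \<gamma> i j * z i * z j) =
        (\<Sum>m\<in>M. \<Sum>i\<in>I. \<Sum>j\<in>I. c m * \<mu> (s m) i * \<mu> (t m) j * z i * z j)"
      unfolding \<gamma>_def sum_distrib_right
      by (subst (2) sum.swap, subst sum.swap, rule refl)
    ultimately show ?thesis
      unfolding Q term_eq sum.distrib \<alpha>_def by simp
  qed
  then show ?thesis unfolding quadratic_on_def by blast
qed

definition sign_vector :: "nat set \<Rightarrow> nat \<Rightarrow> real" where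
  "sign_vector S i = (if i \<in> S then 1 else - 1)"

text \<open>Complementation in \<open>I\<close> flips all signs on \<open>I\<close>; sums of odd
  functions of these signs therefore vanish.\<close>

lemma sum_Pow_complement:
  "(\<Sum>S\<in>Pow I. g S) = (\<Sum>S\<in>Pow I. g (I - S))"
  by (rule sum.reindex_bij_witness[where i = "\<lambda>S. I - S" and j = "\<lambda>S. I - S"])
    (auto simp: double_diff)

text \<open>For distinct i and j, toggling the membership of i is an involution that negates each
  summand.\<close>

lemma sum_sign_vector_orthogonal:
  assumes "finite I" "i \<in> I" "j \<in> I"
  shows "(\<Sum>S\<in>Pow I. sign_vector S i * sign_vector S j) = (if i = j then 2 ^ card I else 0)"
proof (cases "i = j")
  case True
  then have "(\<Sum>S\<in>Pow I. sign_vector S i * sign_vector S j) = (\<Sum>S\<in>Pow I. 1)"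
    by (intro sum.cong) (auto simp: sign_vector_def)
  then show ?thesis using True assms by (simp add: card_Pow)
next
  case False
  let ?toggle = "\<lambda>S. if i \<in> S then S - {i} else insert i S"
  have "(\<Sum>S\<in>Pow I. sign_vector S i * sign_vector S j) =
      (\<Sum>S\<in>Pow I. - (sign_vector S i * sign_vector S j))"
    by (rule sum.reindex_bij_witness[where i = ?toggle and j = ?toggle])
      (use False assms in \<open>auto simp: sign_vector_def\<close>)
  then show ?thesis using False by (simp add: sum_negf)
qed

text \<open>A Parseval identity: after expanding the squares, orthogonality keeps the diagonal
  terms.\<close>

lemma sum_Pow_sign_square:
  fixes \<beta> :: "nat \<Rightarrow> real"
  assumes "finite I"
  shows "(\<Sum>S\<in>Pow I. (\<Sum>i\<in>I. \<beta> i * sign_vector S i)\<^sup>2) = 2 ^ card I * (\<Sum>i\<in>I. (\<beta> i)\<^sup>2)"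
proof -
  have "(\<Sum>S\<in>Pow I. (\<Sum>i\<in>I. \<beta> i * sign_vector S i)\<^sup>2) =
      (\<Sum>S\<in>Pow I. \<Sum>i\<in>I. \<Sum>j\<in>I. \<beta> i * \<beta> j * (sign_vector S i * sign_vector S j))"
    by (simp add: power2_eq_square sum_product mult_ac)
  also have "\<dots> = (\<Sum>i\<in>I. \<Sum>j\<in>I. \<beta> i * \<beta> j * (\<Sum>S\<in>Pow I. sign_vector S i * sign_vector S j))"
    unfolding sum_distrib_left by (subst sum.swap, intro sum.cong refl, rule sum.swap)
  also have "\<dots> = (\<Sum>i\<in>I. \<Sum>j\<in>I. if i = j then 2 ^ card I * (\<beta> i)\<^sup>2 else 0)"
    using assms by (intro sum.cong refl) (simp add: sum_sign_vector_orthogonal power2_eq_square)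
  also have "\<dots> = 2 ^ card I * (\<Sum>i\<in>I. (\<beta> i)\<^sup>2)"
    using assms by (simp add: sum_distrib_left)
  finally show ?thesis .
qed

text \<open>
  The weight of the negative unit vectors is nonpositive for \<open>0 \<le> u \<le> 1\<close>. Still the functional is
  nonnegative on squares of quadratic functions: averaging over the signs keeps at least the square
  of the odd part, and what is left is the average of \<open>(\<beta>\<^sub>i + u (\<alpha> + \<gamma>\<^sub>i\<^sub>i))\<^sup>2\<close>.
\<close>

definition signed_average :: "nat set \<Rightarrow> real \<Rightarrow> ((nat \<Rightarrow> real) \<Rightarrow> real) \<Rightarrow> real" where
  "signed_average I u G =
    (1 - u\<^sup>2) * ((\<Sum>S\<in>Pow I. G (\<lambda>i. sign_vector S i / sqrt (card I))) / 2 ^ card I)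
    + (\<Sum>i\<in>I. (u\<^sup>2 + u) / 2 * G (\<lambda>k. if k = i then 1 else 0)
        + (u\<^sup>2 - u) / 2 * G (\<lambda>k. if k = i then - 1 else 0)) / card I"

lemma signed_average_sum:
  "signed_average I u (\<lambda>z. \<Sum>l\<in>L. G l z) = (\<Sum>l\<in>L. signed_average I u (G l))"
proof -
  have "(\<Sum>S\<in>Pow I. \<Sum>l\<in>L. H l S) = (\<Sum>l\<in>L. \<Sum>S\<in>Pow I. H l S)" for H :: "_ \<Rightarrow> _ \<Rightarrow> real"
    by (rule sum.swap)
  moreover have "(\<Sum>i\<in>I. \<Sum>l\<in>L. H l i) = (\<Sum>l\<in>L. \<Sum>i\<in>I. H l i)" for H :: "_ \<Rightarrow> _ \<Rightarrow> real"
    by (rule sum.swap)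
  ultimately show ?thesis
    by (simp add: signed_average_def sum.distrib sum_distrib_left sum_divide_distrib flip: sum.distrib)
qed

lemma signed_average_square_nonneg:
  assumes I: "finite I" "I \<noteq> {}" and q: "quadratic_on I q" and u: "u\<^sup>2 \<le> 1"
  shows "0 \<le> signed_average I u (\<lambda>z. (q z)\<^sup>2)"
proof -
  define N where "N = card I"
  have N: "0 < N" using I by (auto simp: N_def)
  obtain \<alpha> \<beta> \<gamma> where q: "\<And>z. q z =
     \<alpha> + (\<Sum>i\<in>I. \<beta> i * z i) + (\<Sum>i\<in>I. \<Sum>j\<in>I. \<gamma> i j * z i * z j)"
    using q unfolding quadratic_on_def by blast
  \<comment> \<open>\<open>e\<close> and \<open>h\<close> are the even and odd parts of
    \<open>q\<close>. Flipping all signs shows that their mixed terms cancel in the sum, so the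
    squares of \<open>h\<close> alone bound it from below.\<close>
  define e h where "e = (\<lambda>z. \<alpha> + (\<Sum>i\<in>I. \<Sum>j\<in>I. \<gamma> i j * z i * z j))"
    and "h = (\<lambda>z. \<Sum>i\<in>I. \<beta> i * z i)"
  let ?s = "\<lambda>S i. sign_vector S i / sqrt N"
  have compl: "?s (I - S) i = - ?s S i" if "i \<in> I" for S i
    using that by (simp add: sign_vector_def)
  have eh: "e (?s (I - S)) = e (?s S)" "h (?s (I - S)) = - h (?s S)" for S
    unfolding e_def h_def sum_negf[symmetric]
    by (auto simp: compl intro!: arg_cong2[where f = plus] sum.cong)
  have "(\<Sum>S\<in>Pow I. e (?s S) * h (?s S)) = - (\<Sum>S\<in>Pow I. e (?s S) * h (?s S))"
    by (subst sum_Pow_complement) (simp add: eh sum_negf)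
  then have cross: "(\<Sum>S\<in>Pow I. e (?s S) * h (?s S)) = 0" by simp
  have "(\<Sum>S\<in>Pow I. (q (?s S))\<^sup>2) =
      (\<Sum>S\<in>Pow I. (e (?s S))\<^sup>2) + (\<Sum>S\<in>Pow I. (h (?s S))\<^sup>2)
      + 2 * (\<Sum>S\<in>Pow I. e (?s S) * h (?s S))"
    by (simp add: q e_def h_def power2_eq_square algebra_simps sum.distrib sum_distrib_left)
  then have "(\<Sum>S\<in>Pow I. (h (?s S))\<^sup>2) \<le> (\<Sum>S\<in>Pow I. (q (?s S))\<^sup>2)"
    by (simp add: cross sum_nonneg)
  moreover have "(\<Sum>S\<in>Pow I. (h (?s S))\<^sup>2) = 2 ^ N * ((\<Sum>i\<in>I. (\<beta> i)\<^sup>2) / N)"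
  proof -
    have "(h (?s S))\<^sup>2 = (\<Sum>i\<in>I. \<beta> i * sign_vector S i)\<^sup>2 / N" for S
      by (simp add: h_def power_divide flip: sum_divide_distrib)
    then show ?thesis
      using sum_Pow_sign_square[OF I(1), of \<beta>] by (simp add: N_def flip: sum_divide_distrib)
  qed
  ultimately have sign_part: "(\<Sum>i\<in>I. (\<beta> i)\<^sup>2) / N \<le> (\<Sum>S\<in>Pow I. (q (?s S))\<^sup>2) / 2 ^ N"
    by (simp add: field_simps)
  have unit: "q (\<lambda>k. if k = i then t else 0) = \<alpha> + \<beta> i * t + \<gamma> i i * t * t" if "i \<in> I" for i t
  proof -
    have delta: "(\<Sum>j\<in>I. c j * (if j = i then t else 0)) = c i * t" for c
      using I that by (simp add: if_distrib cong: if_cong)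
    show ?thesis
      unfolding q delta sum_distrib_right[symmetric] ..
  qed
  have "0 \<le> (\<Sum>i\<in>I. (\<beta> i + u * (\<alpha> + \<gamma> i i))\<^sup>2) / N"
    by (simp add: sum_nonneg)
  also have "\<dots> = (1 - u\<^sup>2) * ((\<Sum>i\<in>I. (\<beta> i)\<^sup>2) / N) + (\<Sum>i\<in>I.
      (u\<^sup>2 + u) / 2 * (\<alpha> + \<beta> i + \<gamma> i i)\<^sup>2 + (u\<^sup>2 - u) / 2 * (\<alpha> - \<beta> i + \<gamma> i i)\<^sup>2) / N"
    unfolding times_divide_eq_right add_divide_distrib[symmetric] sum_distrib_left sum.distrib[symmetric]
    by (intro arg_cong[where f = "\<lambda>x. x / real N"] sum.cong refl) (simp add: field_simps power2_eq_square)
  also have "\<dots> \<le> (1 - u\<^sup>2) * ((\<Sum>S\<in>Pow I. (q (?s S))\<^sup>2) / 2 ^ N) + (\<Sum>i\<in>I.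
      (u\<^sup>2 + u) / 2 * (\<alpha> + \<beta> i + \<gamma> i i)\<^sup>2 + (u\<^sup>2 - u) / 2 * (\<alpha> - \<beta> i + \<gamma> i i)\<^sup>2) / N"
    using u sign_part by (intro add_right_mono mult_left_mono) auto
  also have "\<dots> = signed_average I u (\<lambda>z. (q z)\<^sup>2)"
    unfolding signed_average_def N_def[symmetric]
    by (intro arg_cong2[where f = plus] arg_cong[where f = "\<lambda>x. x / real N"] sum.cong refl)
      (simp_all add: unit[of _ 1] unit[of _ "- 1"])
  finally show ?thesis .
qed

lemma const_over_power_tendsto_0:
  fixes c :: real
  shows "(\<lambda>m. c / real m) \<longlonglongrightarrow> 0" "(\<lambda>m. c / real m ^ 2) \<longlonglongrightarrow> 0" "(\<lambda>m. c / real m ^ 3) \<longlonglongrightarrow> 0"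
  by real_asymp+

text \<open>On N coordinates, sign points and unit vectors have p2 = 1; under the signed average p3
  has mean u and p4 has mean u^2 + (1 - u^2) / N. Extra coordinates force p1 = x; their number m
  tends to infinity first, then N does.\<close>

lemma form4_curve_nonneg:
  assumes quad: "\<And>n. \<exists>(L::nat) Q. (\<forall>l. quadratic_form (Q l)) \<and>
      (\<forall>y. form4 c1 c2 c3 c4 c5 (\<Sum>i\<in>{1..n}. y i) (\<Sum>i\<in>{1..n}. y i ^ 2)
        (\<Sum>i\<in>{1..n}. y i ^ 3) (\<Sum>i\<in>{1..n}. y i ^ 4) = (\<Sum>l<L. (Q l y)\<^sup>2))"
    and u: "0 \<le> u" "u \<le> 1"
  shows "0 \<le> form4 c1 c2 c3 c4 c5 x 1 u (u\<^sup>2)"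
proof -
  let ?F = "form4 c1 c2 c3 c4 c5"
  have u2: "u\<^sup>2 \<le> 1" using u by (simp add: power_le_one)
  have approx: "0 \<le> ?F x 1 u (u\<^sup>2 + (1 - u\<^sup>2) / N)" if N: "0 < N" for N :: nat
  proof -
    let ?I = "{1..N}"
    \<comment> \<open>\<open>Gm m\<close> is the form at \<open>z\<close> together with m additional
      equal coordinates; \<open>G\<close> is its limit as m grows.\<close>
    define G where "G = (\<lambda>z. ?F x (\<Sum>i\<in>?I. z i ^ 2) (\<Sum>i\<in>?I. z i ^ 3) (\<Sum>i\<in>?I. z i ^ 4))"
    define Gm where "Gm = (\<lambda>m z. ?F x ((\<Sum>i\<in>?I. z i ^ 2) + (x - (\<Sum>i\<in>?I. z i)) ^ 2 / real m)
      ((\<Sum>i\<in>?I. z i ^ 3) + (x - (\<Sum>i\<in>?I. z i)) ^ 3 / real m ^ 2)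
      ((\<Sum>i\<in>?I. z i ^ 4) + (x - (\<Sum>i\<in>?I. z i)) ^ 4 / real m ^ 3))"
    have "0 \<le> signed_average ?I u (Gm m)" if m: "0 < m" for m
    proof -
      obtain L :: nat and Q where Q: "\<And>l. quadratic_form (Q l)"
        "\<And>y. ?F (\<Sum>i\<in>{1..N + m}. y i) (\<Sum>i\<in>{1..N + m}. y i ^ 2)
          (\<Sum>i\<in>{1..N + m}. y i ^ 3) (\<Sum>i\<in>{1..N + m}. y i ^ 4) = (\<Sum>l<L. (Q l y)\<^sup>2)"
        using quad[of "N + m"] by blast
      \<comment> \<open>\<open>m\<close> further equal coordinates bring the coordinate sum to \<open>x\<close>.\<close>
      define \<kappa> where "\<kappa> = (\<lambda>k. if k \<in> ?I then 0 else x / real m)"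
      define \<mu> where "\<mu> = (\<lambda>k i. if k \<in> ?I then (if k = i then 1 else 0) else - 1 / real m)"
      define y where "y = (\<lambda>z k. \<kappa> k + (\<Sum>i\<in>?I. \<mu> k i * z i))"
      have y_eq: "y z k = (if k \<in> ?I then z k else (x - (\<Sum>i\<in>?I. z i)) / real m)" for z k
      proof (cases "k \<in> ?I")
        case True
        then show ?thesis
          unfolding y_def \<kappa>_def \<mu>_def if_P[OF True]
          by (simp add: if_distrib[of "\<lambda>a. a * _"] cong: if_cong)
      next
        case False
        show ?thesis
          unfolding y_def \<kappa>_def \<mu>_def if_not_P[OF False]
          by (simp add: sum_negf diff_divide_distrib flip: sum_divide_distrib)
      qed
      have sum_y: "(\<Sum>k\<in>{1..N + m}. H (y z k)) =
          (\<Sum>k\<in>?I. H (z k)) + real m * H ((x - (\<Sum>i\<in>?I. z i)) / real m)" for H :: "real \<Rightarrow> real" and z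
        unfolding y_eq by (subst sum.ub_add_nat) auto
      have mt: "real m * (d / real m) = d" "real m * (d / real m)\<^sup>2 = d\<^sup>2 / real m"
        "real m * (d / real m) ^ 3 = d ^ 3 / real m ^ 2"
        "real m * (d / real m) ^ 4 = d ^ 4 / real m ^ 3" for d
        using m by (auto simp: field_simps power2_eq_square power3_eq_cube power4_eq_xxxx)
      have "Gm m z = (\<Sum>l<L. (Q l (y z))\<^sup>2)" for z
        unfolding Q(2)[symmetric] Gm_def sum_y[of "\<lambda>t. t"] sum_y[of "\<lambda>t. t ^ 2"]
          sum_y[of "\<lambda>t. t ^ 3"] sum_y[of "\<lambda>t. t ^ 4"] mt by simp
      then have "Gm m = (\<lambda>z. \<Sum>l<L. (Q l (y z))\<^sup>2)" by (rule ext)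
      then have "signed_average ?I u (Gm m) = (\<Sum>l<L. signed_average ?I u (\<lambda>z. (Q l (y z))\<^sup>2))"
        by (simp only: signed_average_sum)
      also have "\<dots> \<ge> 0"
        unfolding y_def using N u2 Q(1)
        by (intro sum_nonneg signed_average_square_nonneg quadratic_form_affine) auto
      finally show ?thesis .
    qed
    moreover have "(\<lambda>m. Gm m z) \<longlonglongrightarrow> ?F x ((\<Sum>i\<in>?I. z i ^ 2) + 0)
        ((\<Sum>i\<in>?I. z i ^ 3) + 0) ((\<Sum>i\<in>?I. z i ^ 4) + 0)" for z
      unfolding Gm_def form4_def by (intro tendsto_intros const_over_power_tendsto_0)
    then have "(\<lambda>m. Gm m z) \<longlonglongrightarrow> G z" for z by (simp add: G_def)
    then have "(\<lambda>m. signed_average ?I u (Gm m)) \<longlonglongrightarrow> signed_average ?I u G"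
      unfolding signed_average_def using N by (intro tendsto_intros) auto
    ultimately have "0 \<le> signed_average ?I u G"
      by (intro tendsto_lowerbound) (auto intro!: eventually_sequentiallyI[of 1])
    also have "signed_average ?I u G = ?F x 1 u (u\<^sup>2 + (1 - u\<^sup>2) / N)"
    proof -
      \<comment> \<open>The third power sums of the sign points cancel on average, by symmetry.\<close>
      define w where "w = (\<lambda>S. \<Sum>i\<in>?I. (sign_vector S i / sqrt N) ^ 3)"
      have unit: "G (\<lambda>k. if k = i then t else 0) = ?F x (t ^ 2) (t ^ 3) (t ^ 4)" if "i \<in> ?I" for i t
        using that by (simp add: G_def if_distrib[of "\<lambda>a. a ^ _"] cong: if_cong)
      have sv: "sign_vector S i ^ 2 = 1" "sign_vector S i ^ 4 = 1" for S i
        by (auto simp: sign_vector_def)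
      have "sqrt (real N) ^ 4 = (sqrt (real N) ^ 2) ^ 2" by algebra
      then have N4: "sqrt (real N) ^ 4 = real N ^ 2" by simp
      have signs: "G (\<lambda>i. sign_vector S i / sqrt N) = ?F x 1 0 (1 / N) + c3 * x * w S" for S
        using N by (simp add: G_def form4_def w_def power_divide sv N4 power2_eq_square[of "real N"])
      have "w (?I - S) = - w S" for S
        unfolding w_def sum_negf[symmetric]
        by (intro sum.cong) (auto simp: sign_vector_def)
      then have "(\<Sum>S\<in>Pow ?I. w S) = - (\<Sum>S\<in>Pow ?I. w S)"
        by (subst sum_Pow_complement) (simp add: sum_negf)
      then have w0: "(\<Sum>S\<in>Pow ?I. w S) = 0" by simp
      have at_signs: "(\<Sum>S\<in>Pow ?I. G (\<lambda>i. sign_vector S i / sqrt N)) / 2 ^ N = ?F x 1 0 (1 / N)"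
        unfolding signs sum.distrib sum_distrib_left[symmetric] w0 by (simp add: card_Pow)
      have at_units: "(\<Sum>i\<in>?I. (u\<^sup>2 + u) / 2 * G (\<lambda>k. if k = i then 1 else 0)
          + (u\<^sup>2 - u) / 2 * G (\<lambda>k. if k = i then - 1 else 0)) / N =
          (u\<^sup>2 + u) / 2 * ?F x 1 1 1 + (u\<^sup>2 - u) / 2 * ?F x 1 (- 1) 1"
        using N by (simp add: unit[of _ 1] unit[of _ "- 1"])
      have card: "card ?I = N" by simp
      show ?thesis
        unfolding signed_average_def card at_signs at_units form4_def
        using N by (simp add: field_simps power2_eq_square)
    qed
    finally show ?thesis .
  qed
  \<comment> \<open>Letting N grow removes the excess in the fourth power sum.\<close>
  have "(\<lambda>N. ?F x 1 u (u\<^sup>2 + (1 - u\<^sup>2) / real N)) \<longlonglongrightarrow> ?F x 1 u (u\<^sup>2 + 0)"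
    unfolding form4_def by (intro tendsto_intros)
  then have "0 \<le> ?F x 1 u (u\<^sup>2 + 0)"
    by (rule tendsto_lowerbound) (auto intro!: eventually_sequentiallyI[of 1] approx)
  then show ?thesis by simp
qed

theorem theorem3p5:
  fixes c1 c2 c3 c4 c5 :: real and f :: rpoly
  assumes f: "f = Const c1 * Var 1 ^ 4 + Const c2 * Var 2 * Var 1 ^ 2 + Const c3 * Var 3 * Var 1
                + Const c4 * Var 2 ^ 2 + Const c5 * Var 4"
  shows "(nonneg_all_numbers_of_variables f \<longleftrightarrow>
            nonneg_on4 f {(x, 1, real n powr (-1/2), real n powr (-1)) | (x::real) (n::nat). n > 0})
       \<and> (sos_all_numbers_of_variables f \<longleftrightarrow>
            nonneg_on4 f {(x, 1, u, u ^ 2) | (x::real) (u::real). 0 \<le> u \<and> u \<le> 1})"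
proof
  have powr: "real n powr (-1/2) = 1 / sqrt (real n)" "real n powr (-1) = 1 / real n" if "0 < n" for n
    using that by (simp_all add: powr_minus_divide powr_half_sqrt flip: minus_divide_left)
  have points: "nonneg_on4 f {(x, 1, real n powr (-1/2), real n powr (-1)) | (x::real) (n::nat). n > 0}
      \<longleftrightarrow> (\<forall>x n. 0 < n \<longrightarrow> 0 \<le> form4 c1 c2 c3 c4 c5 x 1 (1 / sqrt (real n)) (1 / real n))"
    unfolding nonneg_on4_def using powr fun4_form4[OF f] by fastforce
  show "nonneg_all_numbers_of_variables f \<longleftrightarrow>
      nonneg_on4 f {(x, 1, real n powr (-1/2), real n powr (-1)) | (x::real) (n::nat). n > 0}"
    unfolding points nonneg_all_numbers_of_variables_def nonneg_poly_def eval_in_variables[OF f]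
    by (blast intro: form4_nonneg_power_mean_points form4_nonneg_power_sums finite_atLeastAtMost)
  have curve: "nonneg_on4 f {(x, 1, u, u ^ 2) | (x::real) (u::real). 0 \<le> u \<and> u \<le> 1}
      \<longleftrightarrow> (\<forall>x u. 0 \<le> u \<longrightarrow> u \<le> 1 \<longrightarrow> 0 \<le> form4 c1 c2 c3 c4 c5 x 1 u (u\<^sup>2))"
    unfolding nonneg_on4_def using fun4_form4[OF f] by fastforce
  show "sos_all_numbers_of_variables f \<longleftrightarrow>
      nonneg_on4 f {(x, 1, u, u ^ 2) | (x::real) (u::real). 0 \<le> u \<and> u \<le> 1}"
    unfolding curve
  proof
    assume "sos_all_numbers_of_variables f"
    then have "sos_poly n (in_variables n f)" for n
      by (simp add: sos_all_numbers_of_variables_def)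
    then have "\<exists>(L::nat) Q. (\<forall>l. quadratic_form (Q l)) \<and>
        (\<forall>y. eval_poly (in_variables n f) y = (\<Sum>l<L. (Q l y)\<^sup>2))" for n
      using sos_in_variables_quadratic_forms[OF f, of n] by metis
    from form4_curve_nonneg[OF this[unfolded eval_in_variables[OF f]]]
    show "\<forall>x u. 0 \<le> u \<longrightarrow> u \<le> 1 \<longrightarrow> 0 \<le> form4 c1 c2 c3 c4 c5 x 1 u (u\<^sup>2)"
      by blast
  next
    assume "\<forall>x u. 0 \<le> u \<longrightarrow> u \<le> 1 \<longrightarrow> 0 \<le> form4 c1 c2 c3 c4 c5 x 1 u (u\<^sup>2)"
    then show "sos_all_numbers_of_variables f"
      unfolding sos_all_numbers_of_variables_def in_variables_form[OF f]
      by (blast intro: sos_form4)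
  qed
qed

end
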